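(* Let $\boldsymbol{\delta}=(\delta_\nu)_{\nu=1}^N\colon\mathbb{N}_0\to(0,\infty)^N$. Assume that $r_\nu\ge 5/2$ for all $\nu=1,\dots,n$ with $c_{\cdot,\nu}>0$ and that $0<3\overline{\overline{c}}\le\underline{c_\cdot}$. Suppose that for all $\nu=1,\dots,n$ such that $c_{\cdot,\nu}>0$ and for all $x\in\mathbb{N}$, $$x\,\delta_\nu(x)\le (x+1)\,\delta_\nu(x+1).$$ Suppose further that for every $x\in\mathbb{N}$, at least one of the following two conditions (i), (ii) is satisfied. (i) Both of the following hold: - $\overline{\overline{c}}\,\overline{\delta}(x+1)\le 2(\underline{r}/\overline{r})^2(\underline{c_\cdot}-3\overline{\overline{c}})\rho$ implies $$\Big\{2\Big(\frac{\underline{r}}{\overline{r}}\Big)^2(\underline{c_\cdot}-3\overline{\overline{c}})\rho-\underline{c_\cdot}\Big\}\overline{\delta}(x+1)+2\underline{r}\Big(\frac{\underline{r}}{\overline{r}}\Big)^2(\underline{c_\cdot}-3\overline{\overline{c}})\rho\ge 0;$$ - $\overline{\overline{c}}\,\overline{\delta}(x+1)> 2(\underline{r}/\overline{r})^2(\underline{c_\cdot}-3\overline{\overline{c}})\rho$ implies $$n\Big[\Big\{2\Big(\frac{\underline{r}}{\overline{r}}\Big)^2(\underline{c_\cdot}-3\overline{\overline{c}})\rho-\underline{c_\cdot}\Big\}\overline{\delta}(x+1)+2\underline{r}\Big(\frac{\underline{r}}{\overline{r}}\Big)^2(\underline{c_\cdot}-3\overline{\overline{c}})\rho\Big]\ge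 x\Big\{\overline{\overline{c}}\,\overline{\delta}(x+1)-2\Big(\frac{\underline{r}}{\overline{r}}\Big)^2(\underline{c_\cdot}-3\overline{\overline{c}})\rho\Big\}.$$ (ii) Both of the following hold: - $\overline{\overline{c}}\,\overline{\delta}(x+1)\le 2(\underline{c_\cdot}-3\overline{\overline{c}})\rho$ implies $$2(\underline{c_\cdot}-3\overline{\overline{c}})\rho-(\underline{c_\cdot}-\underline{r}\,\overline{\overline{c}})\ge 0;$$ - $\overline{\overline{c}}\,\overline{\delta}(x+1)> 2(\underline{c_\cdot}-3\overline{\overline{c}})\rho$ implies $$n\{2(\underline{c_\cdot}-3\overline{\overline{c}})\rho-(\underline{c_\cdot}-\underline{r}\,\overline{\overline{c}})\}\overline{\delta}(x+1)\ge\Big(\sum_{\nu=1}^n r_\nu+x\Big)\{\overline{\overline{c}}\,\overline{\delta}(x+1)-2(\underline{c_\cdot}-3\overline{\overline{c}})\rho\}.$$ Then the shrinkage estimator $$\hat{\boldsymbol{p}}^{(\boldsymbol{\delta})}=\Big(\Big(\frac{X_{i,\nu}}{r_\nu+X_{\cdot,\nu}-1+\delta_\nu(X_{\cdot,\cdot})}\Big)_{i=1}^{m_\nu}\Big)_{\nu=1,\dots,N}$$ dominates the UMVU estimator $$\hat{\boldsymbol{p}}^{\rm U}=\Big(\Big(\frac{X_{i,\nu}}{r_\nu+X_{\cdot,\nu}-1}\Big)_{i=1}^{m_\nu}\Big)_{\nu=1,\dots,N}$$ of $\boldsymbol{p}$ under the standardized squared error loss $L_{n,\boldsymbol{c}}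$.
   Context: Notation: $\mathbb{N}=\{1,2,\dots\}$, $\mathbb{N}_0=\{0,1,2,\dots\}$. Let $N\in\mathbb{N}$, $m_1,\dots,m_N\in\mathbb{N}$, $r_1,\dots,r_N>0$. For $\nu=1,\dots,N$, the unknown parameter vector $\boldsymbol{p}_\nu=(p_{i,\nu})_{i=1}^{m_\nu}$ lies in $D_{m_\nu}=\{(q_1,\dots,q_{m_\nu}) : q_i>0 \ \forall i,\ \sum_i q_i<1\}$, and $p_{0,\nu}=1-\sum_{i=1}^{m_\nu}p_{i,\nu}$. The full parameter is $\boldsymbol{p}=(\boldsymbol{p}_\nu)_{\nu=1}^N\in D=D_{m_1}\times\dots\times D_{m_N}$. The observations $\boldsymbol{X}_\nu=(X_{i,\nu})_{i=1}^{m_\nu}$, $\nu=1,\dots,N$, are independent negative multinomial vectors, $\boldsymbol{X}_\nu$ having probability mass function $$\frac{\Gamma(r_\nu+\sum_{i}x_{i,\nu})}{\Gamma(r_\nu)\prod_{i}x_{i,\nu}!}\,p_{0,\nu}^{r_\nu}\prod_{i=1}^{m_\nu}p_{i,\nu}^{x_{i,\nu}},\qquad (x_{i,\nu})_{i=1}^{m_\nu}\in\mathbb{N}_0^{m_\nu}.$$ Put $X_{\cdot,\nu}=\sum_{i=1}^{m_\nu}X_{i,\nu}$ and $X_{\cdot,\cdot}=\sum_{\nu=1}^N X_{\cdot,\nu}$. Loss: fix $n\in\{1,\dots,N\}$ and weights $\boldsymbol{c}=((c_{i,\nu})_{i=1}^{m_\nu})_{\nu=1}^N$ with $c_{i,\nu}\in[0,\infty)$.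 For $\boldsymbol{d}=((d_{i,\nu})_{i=1}^{m_\nu})_{\nu=1}^N$ with real entries, $$L_{n,\boldsymbol{c}}(\boldsymbol{d},\boldsymbol{p})=\sum_{\nu=1}^n\sum_{i=1}^{m_\nu}c_{i,\nu}\frac{(d_{i,\nu}-p_{i,\nu})^2}{p_{i,\nu}}.$$ The risk of an estimator is its expected loss as a function of $\boldsymbol{p}\in D$. An estimator dominates another if its risk is less than or equal to the other's for every $\boldsymbol{p}\in D$, with strict inequality for at least one $\boldsymbol{p}$. Convention: $0/0=0$. Further notation: $\underline{r}=\min_{1\le\nu\le n}r_\nu$, $\overline{r}=\max_{1\le\nu\le n}r_\nu$; $c_{\cdot,\nu}=\sum_{i=1}^{m_\nu}c_{i,\nu}$; $\underline{c_\cdot}=\min_{1\le\nu\le n}c_{\cdot,\nu}$; $\overline{\overline{c}}=\max_{1\le\nu\le n}\max_{1\le i\le m_\nu}c_{i,\nu}$; for $x\in\mathbb{N}_0$, $\underline{\delta}(x)=\min_{1\le\nu\le n}\delta_\nu(x)$ and $\overline{\delta}(x)=\max_{1\le\nu\le n}\delta_\nu(x)$; $\rho=\inf_{x\in\mathbb{N}\setminus\{1\}}\underline{\delta}(x)/\overline{\delta}(x)\in[0,1]$. *)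

theory Defs
  imports "HOL-Probability.Probability"
begin

text \<open>
  Double arrays $(a_{i,\nu})$ are functions applied to the population index first: \<open>a \<nu> i\<close>, with
  \<open>\<nu> \<in> {1..N}\<close> and \<open>i \<in> {1..m \<nu>}\<close>.
\<close>

type_synonym params = "nat \<Rightarrow> nat \<Rightarrow> real"
type_synonym counts = "nat \<Rightarrow> nat \<Rightarrow> nat"

definition prob_simplex :: "nat \<Rightarrow> (nat \<Rightarrow> real) set" where
  "prob_simplex k =
     {q \<in> {1..k} \<rightarrow>\<^sub>E UNIV. (\<forall>i\<in>{1..k}. 0 < q i) \<and> (\<Sum>i=1..k. q i) < 1}"

definition param_space :: "nat \<Rightarrow> (nat \<Rightarrow> nat) \<Rightarrow> params set" where
  "param_space N m = (\<Pi>\<^sub>E \<nu>\<in>{1..N}. prob_simplex (m \<nu>))"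

definition neg_multinomial_mass :: "nat \<Rightarrow> real \<Rightarrow> (nat \<Rightarrow> real) \<Rightarrow> (nat \<Rightarrow> nat) \<Rightarrow> real" where
  "neg_multinomial_mass k s q x =
     Gamma (s + real (\<Sum>i=1..k. x i)) / (Gamma s * (\<Prod>i=1..k. fact (x i)))
       * (1 - (\<Sum>i=1..k. q i)) powr s * (\<Prod>i=1..k. q i ^ x i)"

text \<open>
  The \<open>\<nu>\<close>-th observation is a random vector in the product space indexed by \<open>{1..m \<nu>}\<close>, hence
  the restriction; entries \<open>X \<nu> i\<close> with \<open>i\<close> outside this range play no role.
\<close>

definition neg_multinomial_observations ::
  "nat \<Rightarrow> (nat \<Rightarrow> nat) \<Rightarrow> (nat \<Rightarrow> real) \<Rightarrow> params \<Rightarrow> 'w measure \<Rightarrow> (nat \<Rightarrow> nat \<Rightarrow> 'w \<Rightarrow> nat) \<Rightarrow> bool"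
  where
  "neg_multinomial_observations N m r p M X \<longleftrightarrow>
     prob_space M \<and>
     prob_space.indep_vars M
       (\<lambda>\<nu>. \<Pi>\<^sub>M i\<in>{1..m \<nu>}. count_space UNIV) (\<lambda>\<nu> \<omega>. \<lambda>i\<in>{1..m \<nu>}. X \<nu> i \<omega>) {1..N} \<and>
     (\<forall>\<nu>\<in>{1..N}. \<forall>x.
        measure M {\<omega> \<in> space M. \<forall>i\<in>{1..m \<nu>}. X \<nu> i \<omega> = x i}
          = neg_multinomial_mass (m \<nu>) (r \<nu>) (p \<nu>) x)"

definition loss :: "nat \<Rightarrow> (nat \<Rightarrow> nat) \<Rightarrow> params \<Rightarrow> params \<Rightarrow> params \<Rightarrow> real" where
  "loss n m c d p = (\<Sum>\<nu>=1..n. \<Sum>i=1..m \<nu>. c \<nu> i * ((d \<nu> i - p \<nu> i)\<^sup>2 / p \<nu> i))"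

text \<open>
  \<open>P p\<close> is the probability space underlying the data when the parameter is \<open>p\<close>. The loss is
  nonnegative, so its expectation is taken as a nonnegative extended real and is always defined.
\<close>

definition risk ::
  "(params \<Rightarrow> params \<Rightarrow> real) \<Rightarrow> (params \<Rightarrow> 'w measure) \<Rightarrow> (nat \<Rightarrow> nat \<Rightarrow> 'w \<Rightarrow> nat) \<Rightarrow>
   (counts \<Rightarrow> params) \<Rightarrow> params \<Rightarrow> ennreal" where
  "risk L P X est p = (\<integral>\<^sup>+ \<omega>. ennreal (L (est (\<lambda>\<nu> i. X \<nu> i \<omega>)) p) \<partial>(P p))"

definition dominates ::
  "params set \<Rightarrow> (params \<Rightarrow> params \<Rightarrow> real) \<Rightarrow> (params \<Rightarrow> 'w measure) \<Rightarrow>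
   (nat \<Rightarrow> nat \<Rightarrow> 'w \<Rightarrow> nat) \<Rightarrow> (counts \<Rightarrow> params) \<Rightarrow> (counts \<Rightarrow> params) \<Rightarrow> bool" where
  "dominates D L P X est est' \<longleftrightarrow>
     (\<forall>p\<in>D. risk L P X est p \<le> risk L P X est' p) \<and>
     (\<exists>p\<in>D. risk L P X est p < risk L P X est' p)"

definition row_total :: "(nat \<Rightarrow> nat) \<Rightarrow> counts \<Rightarrow> nat \<Rightarrow> nat" where
  "row_total m x \<nu> = (\<Sum>i=1..m \<nu>. x \<nu> i)"

definition grand_total :: "nat \<Rightarrow> (nat \<Rightarrow> nat) \<Rightarrow> counts \<Rightarrow> nat" where
  "grand_total N m x = (\<Sum>\<nu>=1..N. row_total m x \<nu>)"

text \<open>The convention $0/0 = 0$ is the behaviour of division in HOL.\<close>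

definition umvu_estimator :: "(nat \<Rightarrow> nat) \<Rightarrow> (nat \<Rightarrow> real) \<Rightarrow> counts \<Rightarrow> params" where
  "umvu_estimator m r x = (\<lambda>\<nu> i. real (x \<nu> i) / (r \<nu> + real (row_total m x \<nu>) - 1))"

definition shrinkage_estimator ::
  "nat \<Rightarrow> (nat \<Rightarrow> nat) \<Rightarrow> (nat \<Rightarrow> real) \<Rightarrow> (nat \<Rightarrow> nat \<Rightarrow> real) \<Rightarrow> counts \<Rightarrow> params" where
  "shrinkage_estimator N m r \<delta> x =
     (\<lambda>\<nu> i. real (x \<nu> i) / (r \<nu> + real (row_total m x \<nu>) - 1 + \<delta> \<nu> (grand_total N m x)))"

definition r_min :: "nat \<Rightarrow> (nat \<Rightarrow> real) \<Rightarrow> real" where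
  "r_min n r = (MIN \<nu>\<in>{1..n}. r \<nu>)"

definition r_max :: "nat \<Rightarrow> (nat \<Rightarrow> real) \<Rightarrow> real" where
  "r_max n r = (MAX \<nu>\<in>{1..n}. r \<nu>)"

definition c_total :: "(nat \<Rightarrow> nat) \<Rightarrow> params \<Rightarrow> nat \<Rightarrow> real" where
  "c_total m c \<nu> = (\<Sum>i=1..m \<nu>. c \<nu> i)"

definition c_total_min :: "nat \<Rightarrow> (nat \<Rightarrow> nat) \<Rightarrow> params \<Rightarrow> real" where
  "c_total_min n m c = (MIN \<nu>\<in>{1..n}. c_total m c \<nu>)"

definition c_max :: "nat \<Rightarrow> (nat \<Rightarrow> nat) \<Rightarrow> params \<Rightarrow> real" where
  "c_max n m c = (MAX \<nu>\<in>{1..n}. MAX i\<in>{1..m \<nu>}. c \<nu> i)"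

definition delta_min :: "nat \<Rightarrow> (nat \<Rightarrow> nat \<Rightarrow> real) \<Rightarrow> nat \<Rightarrow> real" where
  "delta_min n \<delta> x = (MIN \<nu>\<in>{1..n}. \<delta> \<nu> x)"

definition delta_max :: "nat \<Rightarrow> (nat \<Rightarrow> nat \<Rightarrow> real) \<Rightarrow> nat \<Rightarrow> real" where
  "delta_max n \<delta> x = (MAX \<nu>\<in>{1..n}. \<delta> \<nu> x)"

definition rho :: "nat \<Rightarrow> (nat \<Rightarrow> nat \<Rightarrow> real) \<Rightarrow> real" where
  "rho n \<delta> = (INF x\<in>{2..}. delta_min n \<delta> x / delta_max n \<delta> x)"

definition condition_i ::
  "nat \<Rightarrow> (nat \<Rightarrow> nat) \<Rightarrow> (nat \<Rightarrow> real) \<Rightarrow> params \<Rightarrow> (nat \<Rightarrow> nat \<Rightarrow> real) \<Rightarrow> nat \<Rightarrow> bool" where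
  "condition_i n m r c \<delta> x \<longleftrightarrow>
     (let rl = r_min n r; ru = r_max n r; cl = c_total_min n m c; cu = c_max n m c;
          du = delta_max n \<delta> (x + 1);
          K = 2 * (rl / ru)\<^sup>2 * (cl - 3 * cu) * rho n \<delta>
      in (cu * du \<le> K \<longrightarrow>
            (K - cl) * du + 2 * rl * (rl / ru)\<^sup>2 * (cl - 3 * cu) * rho n \<delta> \<ge> 0) \<and>
         (cu * du > K \<longrightarrow>
            real n * ((K - cl) * du + 2 * rl * (rl / ru)\<^sup>2 * (cl - 3 * cu) * rho n \<delta>)
              \<ge> real x * (cu * du - K)))"

definition condition_ii ::
  "nat \<Rightarrow> (nat \<Rightarrow> nat) \<Rightarrow> (nat \<Rightarrow> real) \<Rightarrow> params \<Rightarrow> (nat \<Rightarrow> nat \<Rightarrow> real) \<Rightarrow> nat \<Rightarrow> bool" where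
  "condition_ii n m r c \<delta> x \<longleftrightarrow>
     (let rl = r_min n r; cl = c_total_min n m c; cu = c_max n m c;
          du = delta_max n \<delta> (x + 1);
          K = 2 * (cl - 3 * cu) * rho n \<delta>
      in (cu * du \<le> K \<longrightarrow> K - (cl - rl * cu) \<ge> 0) \<and>
         (cu * du > K \<longrightarrow>
            real n * (K - (cl - rl * cu)) * du
              \<ge> ((\<Sum>\<nu>=1..n. r \<nu>) + real x) * (cu * du - K)))"

end

theory Submission
  imports Defs
begin

text \<open>
The loss involves the unknown \<open>1 / p\<^sub>i\<close>, but its expectation can be rewritten without it. Raising one
count by one multiplies a negative multinomial mass by an explicit factor, so that
\<open>E (h X) = p\<^sub>i E ((r + T) / (X\<^sub>i + 1) h (X + e\<^sub>i))\<close> whenever \<open>h\<close> vanishes for \<open>X\<^sub>i = 0\<close>, where \<open>T\<close> is the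
population total (\<open>expectation_increment\<close>). Applied to the squared estimator it shows that the risk of
the shrinkage estimator is, up to a term depending on \<open>p\<close> alone, the expectation of a statistic
\<open>unbiased_loss\<close> (\<open>expectation_loss\<close>). The UMVU estimator is the case \<open>\<delta> = 0\<close>. Hence it suffices to
compare the two statistics at every single array of counts, with strict inequality at the array of
zeros, which has positive probability for every parameter.

Put \<open>a = r + T\<close>, \<open>d = \<delta>(Z)\<close>, \<open>d' = \<delta>(Z + 1)\<close> for the grand total \<open>Z\<close>, and \<open>y = d' / (a + d')\<close>. With
\<open>W = \<Sum> c\<^sub>i X\<^sub>i\<close> and \<open>C = \<Sum> c\<^sub>i\<close>, one population contributes to the difference of the statistics
\<open>(W + C) (y\<^sup>2 - 2 y) / a + 2 W d / ((a - 1) (a - 1 + d))\<close>. The second term is the adverse one.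
Monotonicity of \<open>z \<delta>(z)\<close> together with \<open>r \<ge> 5 / 2\<close> bounds \<open>T d / ((a - 1) (a - 1 + d))\<close> by
\<open>(T + 3) y / a\<close> (\<open>shrinkage_ratio_step\<close>); as \<open>W \<le> k T\<close> for the largest weight \<open>k\<close>, the contribution is at
most \<open>((k T + C) y\<^sup>2 - 2 (C - 3 k) y) / a\<close>, which explains the hypothesis \<open>3 k \<le> C\<close>.

After the individual shrinkage amounts have been replaced by their maximum \<open>D\<close>, at the cost of the
factor \<open>\<rho>\<close> in the favourable term, the contributions are decreasing weights \<open>D / (a (a + D)\<^sup>2)\<close> times
functions that are affine in \<open>T\<close>. If the slope is nonpositive, each term has to be nonpositive; if
it is positive, Chebyshev's sum inequality allows the weights to be dropped, and the totals sum to at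
most \<open>Z\<close>. The conditions (i) and (ii) are what this requires, for two ways of making the weights
comparable when the \<open>r\<^sub>\<nu>\<close> differ (\<open>bound_sum_nonpos_i\<close>, \<open>bound_sum_nonpos_ii\<close>).
\<close>

section \<open>Sums with decreasing weights\<close>

lemma Chebyshev_sum_antitone:
  fixes w b :: "'a \<Rightarrow> real"
  assumes "\<And>i j. i \<in> A \<Longrightarrow> j \<in> A \<Longrightarrow> (w i - w j) * (b i - b j) \<le> 0"
  shows "real (card A) * (\<Sum>i\<in>A. w i * b i) \<le> (\<Sum>i\<in>A. w i) * (\<Sum>i\<in>A. b i)"
proof -
  have "(\<Sum>i\<in>A. \<Sum>j\<in>A. (w i - w j) * (b i - b j)) \<le> 0"
    by (intro sum_nonpos assms)
  moreover have "(\<Sum>j\<in>A. (w i - w j) * (b i - b j)) = real (card A) * (w i * b i)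
      - w i * (\<Sum>j\<in>A. b j) - b i * (\<Sum>j\<in>A. w j) + (\<Sum>j\<in>A. w j * b j)" for i
    by (simp add: algebra_simps sum.distrib sum_subtractf sum_distrib_left)
  then have "(\<Sum>i\<in>A. \<Sum>j\<in>A. (w i - w j) * (b i - b j)) =
      2 * (real (card A) * (\<Sum>i\<in>A. w i * b i) - (\<Sum>i\<in>A. w i) * (\<Sum>i\<in>A. b i))"
    by (simp add: sum.distrib sum_subtractf flip: sum_distrib_left sum_distrib_right)
  ultimately show ?thesis by simp
qed

text \<open>
The weight \<open>d / (s * (s + d)\<^sup>2)\<close> is decreasing in \<open>s\<close>. If the slope \<open>\<beta>\<close> is positive, weight
and affine factor are oppositely ordered, so Chebyshev's inequality reduces the claim to the
unweighted sum; otherwise every single term must be nonpositive. This case distinction is the origin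
of the two implications in each of the conditions (i) and (ii).
\<close>

lemma weighted_affine_sum_nonpos:
  fixes s :: "'a \<Rightarrow> real"
  assumes A: "finite A" "A \<noteq> {}" and s: "\<And>i. i \<in> A \<Longrightarrow> 0 < s i" and d: "0 < d"
    and le: "\<beta> \<le> 0 \<Longrightarrow> (\<And>i. i \<in> A \<Longrightarrow> \<alpha> + \<beta> * s i \<le> 0)"
    and gt: "0 < \<beta> \<Longrightarrow> (\<Sum>i\<in>A. \<alpha> + \<beta> * s i) \<le> 0"
  shows "(\<Sum>i\<in>A. d / (s i * (s i + d)\<^sup>2) * (\<alpha> + \<beta> * s i)) \<le> 0"
proof (cases "\<beta> \<le> 0")
  case True
  show ?thesis
    by (intro sum_nonpos mult_nonneg_nonpos le[OF True])
       (use s d in \<open>auto intro!: divide_nonneg_nonneg mult_nonneg_nonneg simp: less_imp_le\<close>)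
next
  case False
  define w where "w i = d / (s i * (s i + d)\<^sup>2)" for i
  have w0: "0 \<le> w i" if "i \<in> A" for i
    using s[OF that] d by (simp add: w_def)
  have w_antimono: "w j \<le> w i" if "i \<in> A" "j \<in> A" "s i \<le> s j" for i j
    unfolding w_def
    by (intro divide_left_mono mult_mono power_mono mult_pos_pos)
       (use that s[of i] s[of j] d in auto)
  have "(w i - w j) * ((\<alpha> + \<beta> * s i) - (\<alpha> + \<beta> * s j)) \<le> 0" if ij: "i \<in> A" "j \<in> A" for i j
  proof (cases "s i \<le> s j")
    case True
    then show ?thesis
      using w_antimono[OF ij True] False by (intro mult_nonneg_nonpos) auto
  next
    case s: False
    then show ?thesis
      using w_antimono[of j i] ij False by (intro mult_nonpos_nonneg) auto
  qed
  then have "real (card A) * (\<Sum>i\<in>A. w i * (\<alpha> + \<beta> * s i)) \<le>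
      (\<Sum>i\<in>A. w i) * (\<Sum>i\<in>A. \<alpha> + \<beta> * s i)"
    by (rule Chebyshev_sum_antitone)
  also have "\<dots> \<le> 0"
    using gt False w0 by (intro mult_nonneg_nonpos sum_nonneg) auto
  finally show ?thesis
    using A by (simp add: w_def mult_le_0_iff card_gt_0_iff)
qed

section \<open>The contribution of a single population\<close>

text \<open>
With \<open>a = r + t\<close>, the left fraction is what shrinking by \<open>d\<close> takes off \<open>1 / (a - 1)\<close>, and the right
one what shrinking by \<open>d'\<close> takes off \<open>1 / a\<close>: the price of replacing
\<open>a - 1\<close> by \<open>a\<close> is an increase of the factor in front by \<open>3\<close>. The constants \<open>3\<close> and \<open>5 / 2\<close>
belong together: \<open>(t + 3) * (a - 1)\<^sup>2 - (t + 1) * a\<^sup>2 = (2 * r - 5) * t + 2 * r\<^sup>2 - 6 * r + 3\<close>, and this is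
nonnegative for all \<open>t \<ge> 0\<close> exactly when \<open>r \<ge> 5 / 2\<close>.
\<close>

lemma shrinkage_ratio_step:
  fixes t :: real
  assumes t: "0 \<le> t" and a: "t + 5 / 2 \<le> a" and d: "0 < d" "0 < d'"
    and mono: "t * d \<le> (t + 1) * d'"
  shows "t * (d / ((a - 1) * (a - 1 + d))) \<le> (t + 3) * (d' / (a * (a + d')))"
proof -
  have "t * d * a\<^sup>2 \<le> (t + 1) * d' * a\<^sup>2"
    using mono by (intro mult_right_mono) auto
  also have "(t + 1) * a\<^sup>2 \<le> (t + 3) * (a - 1)\<^sup>2"
  proof -
    obtain e where e: "a = t + 5 / 2 + e" "0 \<le> e"
      using a by (metis add.commute diff_add_cancel diff_ge_0_iff_ge)
    \<comment> \<open>The excess \<open>e\<close> of \<open>r\<close> over \<open>5 / 2\<close> makes all coefficients nonnegative.\<close>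
    have "(t + 3) * (a - 1)\<^sup>2 - (t + 1) * a\<^sup>2 = 1 / 2 + 2 * e * t + 4 * e + 2 * e\<^sup>2"
      unfolding e(1) by (simp add: power2_eq_square field_simps)
    also have "\<dots> \<ge> 0"
      using e t by simp
    finally show ?thesis by simp
  qed
  then have "(t + 1) * d' * a\<^sup>2 \<le> (t + 3) * d' * (a - 1)\<^sup>2"
    using d(2) by (metis (no_types, lifting) less_imp_le mult.assoc mult.commute mult_left_mono)
  finally have "t * d * a\<^sup>2 \<le> (t + 3) * d' * (a - 1)\<^sup>2" .
  \<comment> \<open>Because \<open>(t + 3) * (a - 1) - t * a = 3 * (a - 1) - t\<close>.\<close>
  moreover have "d * d' * (t * a) \<le> d * d' * ((t + 3) * (a - 1))"
    using d a t by (intro mult_left_mono) (auto simp: algebra_simps)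
  ultimately have "t * d * (a * (a + d')) \<le> (t + 3) * d' * ((a - 1) * (a - 1 + d))"
    by (simp add: algebra_simps power2_eq_square)
  then show ?thesis
    using a t d by (simp add: divide_simps mult_ac)
qed

text \<open>
The left side is one population's share of the difference of the two unbiased risk estimates, with
\<open>a = r + t\<close> for its total count \<open>t\<close>, weighted count \<open>W\<close> and total weight \<open>C\<close>, and with the
shrinkage amounts \<open>d\<close>, \<open>d'\<close> at the current and at the next grand total. Both brackets become
expressions in \<open>y\<close>: the first is exactly \<open>(y\<^sup>2 - 2 * y) / a\<close>, and the second is at most
\<open>(1 + 3 / t) * y / a\<close> by \<open>shrinkage_ratio_step\<close>. The terms linear in \<open>W\<close> then cancel, which leaves the
favourable term \<open>- 2 * (C - 3 * k) * y\<close>.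
\<close>

lemma population_difference_le:
  fixes t :: real
  assumes t: "0 \<le> t" and a: "t + 5 / 2 \<le> a" and d: "0 < d" "0 < d'"
    and mono: "t * d \<le> (t + 1) * d'" and W: "0 \<le> W" "W \<le> k * t" and k: "0 \<le> k"
  defines "y \<equiv> d' / (a + d')"
  shows "(W + C) * (a / (a + d')\<^sup>2 - 1 / a) + 2 * W * (1 / (a - 1) - 1 / (a - 1 + d))
           \<le> ((k * t + C) * y\<^sup>2 - 2 * (C - 3 * k) * y) / a"
proof -
  have y: "0 < y" and a0: "0 < a"
    using a t d by (auto simp: y_def)
  have "a / (a + d')\<^sup>2 - 1 / a = (y\<^sup>2 - 2 * y) / a"
    using a0 d unfolding y_def
    by (simp add: divide_simps) (simp add: power2_eq_square algebra_simps)
  moreover have "1 / (a - 1) - 1 / (a - 1 + d) = d / ((a - 1) * (a - 1 + d))"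
    using a t d by (simp add: divide_simps)
  moreover have "W * (d / ((a - 1) * (a - 1 + d))) \<le> (W + 3 * k) * (y / a)"
  proof (cases "t = 0")
    case True
    then show ?thesis using W k y a0 by simp
  next
    case False
    then have t': "0 < t" using t by simp
    have "t * (d / ((a - 1) * (a - 1 + d))) \<le> (t + 3) * (y / a)"
      using shrinkage_ratio_step[OF t a d mono] by (simp add: y_def mult_ac)
    then have "W / t * (t * (d / ((a - 1) * (a - 1 + d)))) \<le> W / t * ((t + 3) * (y / a))"
      using W t' by (intro mult_left_mono) auto
    also have "\<dots> = (W + 3 * (W / t)) * (y / a)"
      using t' by (simp add: field_simps)
    also have "\<dots> \<le> (W + 3 * k) * (y / a)"
      using W t' y a0 by (intro mult_right_mono) (auto simp: divide_simps algebra_simps)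
    finally show ?thesis using t' by simp
  qed
  ultimately have "(W + C) * (a / (a + d')\<^sup>2 - 1 / a) + 2 * W * (1 / (a - 1) - 1 / (a - 1 + d))
      \<le> (W + C) * ((y\<^sup>2 - 2 * y) / a) + 2 * ((W + 3 * k) * (y / a))"
    by simp
  also have "\<dots> = ((W + C) * y\<^sup>2 - 2 * (C - 3 * k) * y) / a"
    using a0 by (simp add: field_simps)
  also have "\<dots> \<le> ((k * t + C) * y\<^sup>2 - 2 * (C - 3 * k) * y) / a"
    using W a0 by (intro divide_right_mono diff_right_mono mult_right_mono) auto
  finally show ?thesis .
qed

text \<open>
Removes the dependence of the bound on the population's own weight \<open>C\<close> and shrinkage \<open>d\<close>, in favour
of the lower bound \<open>C0\<close> and the upper bound \<open>D\<close>. The coefficient of \<open>C\<close> is \<open>y\<^sup>2 - 2 * y \<le> 0\<close>; in the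
quadratic term \<open>y\<close> increases to \<open>D / (a + D)\<close>, in the linear one it decreases to \<open>\<rho>\<close> times that.
\<close>

lemma population_bound_uniform:
  fixes t :: real
  assumes t: "0 \<le> t" and a: "0 < a" and k: "0 \<le> k"
    and d: "0 < d" "d \<le> D" "\<rho> * D \<le> d" and \<rho>: "0 \<le> \<rho>" "\<rho> \<le> 1"
    and C: "C0 \<le> C" "3 * k \<le> C0"
  defines "y \<equiv> d / (a + d)"
  shows "((k * t + C) * y\<^sup>2 - 2 * (C - 3 * k) * y) / a
           \<le> D / (a * (a + D)\<^sup>2) * ((k * t + C0) * D - 2 * (C0 - 3 * k) * \<rho> * (a + D))"
proof -
  define Y where "Y = D / (a + D)"
  have D: "0 < D" using d by simp
  have y: "0 < y" "y < 1" "y \<le> Y"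
    using a d D by (auto simp: y_def Y_def divide_simps algebra_simps)
  have "\<rho> * D * (a + d) = \<rho> * D * a + \<rho> * (D * d)"
    by (simp add: algebra_simps)
  also have "\<dots> \<le> d * a + 1 * (D * d)"
    using d \<rho> a D by (intro add_mono mult_right_mono) auto
  also have "\<dots> = d * (a + D)"
    by (simp add: algebra_simps)
  finally have rY: "\<rho> * Y \<le> y"
    using a d D by (simp add: y_def Y_def pos_divide_le_eq pos_le_divide_eq)
  have "(k * t + C) * y\<^sup>2 - 2 * (C - 3 * k) * y
      = (k * t + C0) * y\<^sup>2 - 2 * (C0 - 3 * k) * y - (C - C0) * (y * (2 - y))"
    by (simp add: algebra_simps power2_eq_square)
  also have "\<dots> \<le> (k * t + C0) * y\<^sup>2 - 2 * (C0 - 3 * k) * y"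
    using C y by simp
  also have "\<dots> \<le> (k * t + C0) * Y\<^sup>2 - 2 * (C0 - 3 * k) * (\<rho> * Y)"
    using C y k t rY by (intro diff_mono mult_left_mono power_mono) auto
  finally have "((k * t + C) * y\<^sup>2 - 2 * (C - 3 * k) * y) / a
      \<le> ((k * t + C0) * Y\<^sup>2 - 2 * (C0 - 3 * k) * (\<rho> * Y)) / a"
    using a by (intro divide_right_mono) auto
  also have "\<dots> = D / (a * (a + D)\<^sup>2) * ((k * t + C0) * D - 2 * (C0 - 3 * k) * \<rho> * (a + D))"
    using a D unfolding Y_def
    by (simp add: divide_simps) (simp add: power2_eq_square algebra_simps)
  finally show ?thesis .
qed

section \<open>Summation over the populations\<close>

text \<open>
Condition (ii) takes \<open>s\<^sub>i = r\<^sub>i + t\<^sub>i\<close> itself as the argument of the decreasing weight. For this the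
affine factor has to be a function of \<open>s\<^sub>i\<close>, and \<open>k * t\<^sub>i = k * s\<^sub>i - k * r\<^sub>i \<le> k * s\<^sub>i - k * rl\<close>.
\<close>

lemma bound_sum_nonpos_ii:
  fixes r t :: "'a \<Rightarrow> real"
  assumes A: "finite A" "A \<noteq> {}" and r: "\<And>i. i \<in> A \<Longrightarrow> rl \<le> r i" and rl: "0 < rl"
    and t: "\<And>i. i \<in> A \<Longrightarrow> 0 \<le> t i" "sum t A \<le> x" and D: "0 < D" and k: "0 \<le> k"
    and le: "k * D \<le> K \<Longrightarrow> 0 \<le> K - (C - rl * k)"
    and gt: "K < k * D \<Longrightarrow> (sum r A + x) * (k * D - K) \<le> real (card A) * (K - (C - rl * k)) * D"
  shows "(\<Sum>i\<in>A. D / ((r i + t i) * (r i + t i + D)\<^sup>2)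
            * ((k * t i + C) * D - K * (r i + t i + D))) \<le> 0"
proof -
  define \<alpha> where "\<alpha> = (C - rl * k - K) * D"
  define \<beta> where "\<beta> = k * D - K"
  have pos: "0 < r i + t i" if "i \<in> A" for i
    using r[OF that] t(1)[OF that] rl by linarith
  have "(\<Sum>i\<in>A. D / ((r i + t i) * (r i + t i + D)\<^sup>2)
            * ((k * t i + C) * D - K * (r i + t i + D)))
     \<le> (\<Sum>i\<in>A. D / ((r i + t i) * (r i + t i + D)\<^sup>2) * (\<alpha> + \<beta> * (r i + t i)))"
  proof (intro sum_mono mult_left_mono)
    fix i assume i: "i \<in> A"
    have "k * D * rl \<le> k * D * r i"
      using r[OF i] k D by (intro mult_left_mono) auto
    then show "(k * t i + C) * D - K * (r i + t i + D) \<le> \<alpha> + \<beta> * (r i + t i)"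
      by (simp add: \<alpha>_def \<beta>_def algebra_simps)
    show "0 \<le> D / ((r i + t i) * (r i + t i + D)\<^sup>2)"
      using pos[OF i] D by simp
  qed
  also have "\<dots> \<le> 0"
  proof (rule weighted_affine_sum_nonpos[OF A pos D])
    fix i assume \<beta>: "\<beta> \<le> 0" and i: "i \<in> A"
    have "0 \<le> (K - (C - rl * k)) * D"
      using le \<beta> D by (intro mult_nonneg_nonneg) (auto simp: \<beta>_def)
    moreover have "\<beta> * (r i + t i) \<le> 0"
      using \<beta> pos[OF i] by (intro mult_nonpos_nonneg) auto
    ultimately show "\<alpha> + \<beta> * (r i + t i) \<le> 0"
      by (simp add: \<alpha>_def algebra_simps)
  next
    assume \<beta>: "0 < \<beta>"
    have "(\<Sum>i\<in>A. \<alpha> + \<beta> * (r i + t i)) = real (card A) * \<alpha> + \<beta> * (sum r A + sum t A)"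
      by (simp add: sum.distrib flip: sum_distrib_left)
    also have "\<dots> \<le> real (card A) * \<alpha> + \<beta> * (sum r A + x)"
      using \<beta> t by simp
    also have "\<dots> \<le> 0"
      using gt \<beta> by (simp add: \<alpha>_def \<beta>_def algebra_simps)
    finally show "(\<Sum>i\<in>A. \<alpha> + \<beta> * (r i + t i)) \<le> 0" .
  qed
  finally show ?thesis .
qed

text \<open>
Condition (i) instead replaces all \<open>r\<^sub>i\<close> in the weights by their minimum \<open>rl\<close>. The positive part of a
term only grows; the negative part can be kept at the price of the factor \<open>(rl / ru)\<^sup>2\<close>, because
\<open>rl + t\<^sub>i \<ge> (rl / ru) * (r\<^sub>i + t\<^sub>i)\<close>, and likewise with \<open>D\<close> added on both sides.
\<close>

lemma bound_sum_nonpos_i: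
  fixes r t :: "'a \<Rightarrow> real"
  assumes A: "finite A" "A \<noteq> {}" and r: "\<And>i. i \<in> A \<Longrightarrow> rl \<le> r i" "\<And>i. i \<in> A \<Longrightarrow> r i \<le> ru"
    and rl: "0 < rl"
    and t: "\<And>i. i \<in> A \<Longrightarrow> 0 \<le> t i" "sum t A \<le> x" and D: "0 < D" and k: "0 \<le> k"
    and C: "0 \<le> C" and L: "0 \<le> L"
  defines "K \<equiv> (rl / ru)\<^sup>2 * L"
  assumes le: "k * D \<le> K \<Longrightarrow> 0 \<le> (K - C) * D + rl * K"
    and gt: "K < k * D \<Longrightarrow> x * (k * D - K) \<le> real (card A) * ((K - C) * D + rl * K)"
  shows "(\<Sum>i\<in>A. D / ((r i + t i) * (r i + t i + D)\<^sup>2)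
            * ((k * t i + C) * D - L * (r i + t i + D))) \<le> 0"
proof -
  define \<alpha> where "\<alpha> = (C - rl * k - K) * D"
  define \<beta> where "\<beta> = k * D - K"
  have affine: "\<alpha> + \<beta> * (rl + t i) = (k * t i + C) * D - K * (rl + t i + D)" for i
    by (simp add: \<alpha>_def \<beta>_def algebra_simps)
  have pos: "0 < rl + t i" if "i \<in> A" for i
    using t(1)[OF that] rl by linarith
  have "(\<Sum>i\<in>A. D / ((r i + t i) * (r i + t i + D)\<^sup>2)
            * ((k * t i + C) * D - L * (r i + t i + D)))
     \<le> (\<Sum>i\<in>A. D / ((rl + t i) * (rl + t i + D)\<^sup>2) * (\<alpha> + \<beta> * (rl + t i)))"
  proof (intro sum_mono)
    fix i assume i: "i \<in> A"
    \<comment> \<open>Here \<open>b \<le> a\<close>, but \<open>b\<close> is at least \<open>rl / ru\<close> times as large as \<open>a\<close>.\<close>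
    define a b where "a = r i + t i" and "b = rl + t i"
    have b: "0 < b" "b \<le> a" and ru: "0 < ru" "rl \<le> ru"
      using pos[OF i] r[OF i] rl by (auto simp: a_def b_def)
    have "rl * r i \<le> rl * ru" "rl * t i \<le> ru * t i" "rl * D \<le> ru * D"
      using r[OF i] t(1)[OF i] ru rl D by (intro mult_left_mono mult_right_mono; simp)+
    then have ab: "rl / ru * a \<le> b" "rl / ru * (a + D) \<le> b + D"
      using ru by (auto simp: a_def b_def divide_simps algebra_simps)
    have "(rl / ru * a) * (rl / ru * (a + D)) \<le> b * (b + D)"
      using ab b ru rl D by (intro mult_mono) auto
    then have "(rl / ru)\<^sup>2 * (a * (a + D)) \<le> b * (b + D)"
      by (simp add: power2_eq_square mult_ac)
    then have "(rl / ru)\<^sup>2 * (a * (a + D)) / ((b * (b + D)) * (a * (a + D)))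
        \<le> b * (b + D) / ((b * (b + D)) * (a * (a + D)))"
      using b D by (intro divide_right_mono) auto
    then have "(rl / ru)\<^sup>2 / (b * (b + D)) \<le> 1 / (a * (a + D))"
      using b D by simp
    then have "L * D * ((rl / ru)\<^sup>2 / (b * (b + D))) \<le> L * D * (1 / (a * (a + D)))"
      using L D by (intro mult_left_mono) auto
    moreover have "(k * t i + C) * D\<^sup>2 / (a * (a + D)\<^sup>2) \<le> (k * t i + C) * D\<^sup>2 / (b * (b + D)\<^sup>2)"
      by (intro divide_left_mono mult_mono power_mono mult_nonneg_nonneg mult_pos_pos)
         (use b D C k t(1)[OF i] in auto)
    moreover have split: "D / (z * (z + D)\<^sup>2) * ((k * t i + C) * D - M * (z + D)) =
        (k * t i + C) * D\<^sup>2 / (z * (z + D)\<^sup>2) - M * D * (1 / (z * (z + D)))" if "0 < z" for z M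
      using that D by (simp add: divide_simps) (simp add: power2_eq_square algebra_simps)
    ultimately show "D / ((r i + t i) * (r i + t i + D)\<^sup>2)
            * ((k * t i + C) * D - L * (r i + t i + D))
      \<le> D / ((rl + t i) * (rl + t i + D)\<^sup>2) * (\<alpha> + \<beta> * (rl + t i))"
      unfolding affine[of i, folded b_def] a_def[symmetric] b_def[symmetric]
      using split[of a L] split[of b K] b by (simp add: K_def mult_ac)
  qed
  also have "\<dots> \<le> 0"
  proof (rule weighted_affine_sum_nonpos[OF A pos D])
    fix i assume \<beta>: "\<beta> \<le> 0" and i: "i \<in> A"
    have "0 \<le> (K - C) * D + rl * K"
      using le \<beta> by (auto simp: \<beta>_def)
    moreover have "\<beta> * t i \<le> 0"
      using \<beta> t(1)[OF i] by (intro mult_nonpos_nonneg) auto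
    ultimately show "\<alpha> + \<beta> * (rl + t i) \<le> 0"
      by (simp add: \<alpha>_def \<beta>_def algebra_simps)
  next
    assume \<beta>: "0 < \<beta>"
    have "(\<Sum>i\<in>A. \<alpha> + \<beta> * (rl + t i)) = real (card A) * (\<alpha> + \<beta> * rl) + \<beta> * sum t A"
      by (simp add: sum.distrib distrib_left flip: sum_distrib_left)
    also have "\<dots> \<le> real (card A) * (\<alpha> + \<beta> * rl) + \<beta> * x"
      using \<beta> t by simp
    also have "\<dots> \<le> 0"
      using gt \<beta> by (simp add: \<alpha>_def \<beta>_def algebra_simps)
    finally show "(\<Sum>i\<in>A. \<alpha> + \<beta> * (rl + t i)) \<le> 0" .
  qed
  finally show ?thesis .
qed

section \<open>Comparison of the unbiased risk estimates\<close>

text \<open>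
Its expectation is that of \<open>\<Sum> c (d\<^sup>2 / p - 2 d)\<close> for the shrinkage estimator \<open>d\<close>, that is, the risk
up to a constant depending on \<open>p\<close> alone, while the parameter does not enter its value
(\<open>expectation_loss\<close>).
\<close>

definition unbiased_loss ::
  "nat \<Rightarrow> nat \<Rightarrow> (nat \<Rightarrow> nat) \<Rightarrow> (nat \<Rightarrow> real) \<Rightarrow> params \<Rightarrow> (nat \<Rightarrow> nat \<Rightarrow> real) \<Rightarrow> counts \<Rightarrow> real"
  where
  "unbiased_loss n N m r c \<delta> x =
     (\<Sum>\<nu>=1..n. \<Sum>i=1..m \<nu>. c \<nu> i *
        ((r \<nu> + real (row_total m x \<nu>)) * (real (x \<nu> i) + 1)
             / (r \<nu> + real (row_total m x \<nu>) + \<delta> \<nu> (grand_total N m x + 1))\<^sup>2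
         - 2 * (real (x \<nu> i) / (r \<nu> + real (row_total m x \<nu>) - 1 + \<delta> \<nu> (grand_total N m x)))))"

lemma weighted_loss_difference:
  fixes c x :: "'a \<Rightarrow> real"
  assumes "a \<noteq> 0"
  shows "(\<Sum>i\<in>I. c i * (a * (x i + 1) / (a + d')\<^sup>2 - 2 * (x i / (a - 1 + d))))
       - (\<Sum>i\<in>I. c i * (a * (x i + 1) / a\<^sup>2 - 2 * (x i / (a - 1))))
     = ((\<Sum>i\<in>I. c i * x i) + (\<Sum>i\<in>I. c i)) * (a / (a + d')\<^sup>2 - 1 / a)
       + 2 * (\<Sum>i\<in>I. c i * x i) * (1 / (a - 1) - 1 / (a - 1 + d))"
proof -
  have "c i * (a * (x i + 1) / (a + d')\<^sup>2 - 2 * (x i / (a - 1 + d)))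
      - c i * (a * (x i + 1) / a\<^sup>2 - 2 * (x i / (a - 1)))
      = (c i * x i + c i) * (a / (a + d')\<^sup>2 - 1 / a)
        + 2 * (c i * x i) * (1 / (a - 1) - 1 / (a - 1 + d))" for i
  proof -
    have "a * (x i + 1) / a\<^sup>2 = (x i + 1) * (1 / a)"
      using assms by (simp add: power2_eq_square)
    then show ?thesis by (simp add: algebra_simps)
  qed
  then show ?thesis
    by (simp add: sum.distrib flip: sum_subtractf sum_distrib_left sum_distrib_right)
qed

lemma unbiased_loss_difference:
  assumes "\<And>\<nu>. \<nu> \<in> {1..n} \<Longrightarrow> 0 < r \<nu>"
  shows "unbiased_loss n N m r c \<delta> x - unbiased_loss n N m r c (\<lambda>_ _. 0) x =
    (\<Sum>\<nu>=1..n. let a = r \<nu> + real (row_total m x \<nu>); W = (\<Sum>i=1..m \<nu>. c \<nu> i * real (x \<nu> i))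
       in (W + c_total m c \<nu>) * (a / (a + \<delta> \<nu> (grand_total N m x + 1))\<^sup>2 - 1 / a)
          + 2 * W * (1 / (a - 1) - 1 / (a - 1 + \<delta> \<nu> (grand_total N m x))))"
  unfolding unbiased_loss_def Let_def
proof (subst sum_subtractf[symmetric], intro sum.cong refl)
  fix \<nu> assume "\<nu> \<in> {1..n}"
  from assms[OF this] have "r \<nu> + real (row_total m x \<nu>) \<noteq> 0" by simp
  from weighted_loss_difference[OF this, where c = "c \<nu>" and x = "\<lambda>i. real (x \<nu> i)"
        and I = "{1..m \<nu>}" and d' = "\<delta> \<nu> (grand_total N m x + 1)"
        and d = "\<delta> \<nu> (grand_total N m x)", folded c_total_def]
  show "(\<Sum>i=1..m \<nu>. c \<nu> i *
        ((r \<nu> + real (row_total m x \<nu>)) * (real (x \<nu> i) + 1)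
             / (r \<nu> + real (row_total m x \<nu>) + \<delta> \<nu> (grand_total N m x + 1))\<^sup>2
         - 2 * (real (x \<nu> i) / (r \<nu> + real (row_total m x \<nu>) - 1 + \<delta> \<nu> (grand_total N m x))))) -
     (\<Sum>i=1..m \<nu>. c \<nu> i *
        ((r \<nu> + real (row_total m x \<nu>)) * (real (x \<nu> i) + 1)
             / (r \<nu> + real (row_total m x \<nu>) + 0)\<^sup>2
         - 2 * (real (x \<nu> i) / (r \<nu> + real (row_total m x \<nu>) - 1 + 0)))) =
     ((\<Sum>i=1..m \<nu>. c \<nu> i * real (x \<nu> i)) + c_total m c \<nu>) *
       ((r \<nu> + real (row_total m x \<nu>)) /
          (r \<nu> + real (row_total m x \<nu>) + \<delta> \<nu> (grand_total N m x + 1))\<^sup>2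
        - 1 / (r \<nu> + real (row_total m x \<nu>)))
     + 2 * (\<Sum>i=1..m \<nu>. c \<nu> i * real (x \<nu> i)) *
       (1 / (r \<nu> + real (row_total m x \<nu>) - 1)
        - 1 / (r \<nu> + real (row_total m x \<nu>) - 1 + \<delta> \<nu> (grand_total N m x)))"
    by simp
qed

text \<open>
Without any count in the populations that enter the loss, only the terms
\<open>c * (a / (a + d)\<^sup>2 - 1 / a) < 0\<close> remain. This point makes the domination strict, and it is treated
apart because \<open>rho\<close> controls the shrinkage amounts only from argument \<open>2\<close> on.
\<close>

lemma unbiased_loss_less_at_zero:
  assumes n: "1 \<le> n" and r: "\<And>\<nu>. \<nu> \<in> {1..n} \<Longrightarrow> 0 < r \<nu>"
    and C: "\<And>\<nu>. \<nu> \<in> {1..n} \<Longrightarrow> 0 < c_total m c \<nu>"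
    and \<delta>: "\<And>\<nu> z. \<nu> \<in> {1..n} \<Longrightarrow> 0 < \<delta> \<nu> z"
    and x: "\<And>\<nu> i. \<nu> \<in> {1..n} \<Longrightarrow> i \<in> {1..m \<nu>} \<Longrightarrow> x \<nu> i = 0"
  shows "unbiased_loss n N m r c \<delta> x < unbiased_loss n N m r c (\<lambda>_ _. 0) x"
proof -
  have "unbiased_loss n N m r c \<delta> x - unbiased_loss n N m r c (\<lambda>_ _. 0) x < (\<Sum>\<nu>=1..n. 0)"
  proof (subst unbiased_loss_difference[OF r], assumption, unfold Let_def, rule sum_strict_mono)
    fix \<nu> assume \<nu>: "\<nu> \<in> {1..n}"
    have T: "row_total m x \<nu> = 0" and W: "(\<Sum>i=1..m \<nu>. c \<nu> i * real (x \<nu> i)) = 0"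
      using x[OF \<nu>] by (auto simp: row_total_def)
    have "r \<nu> / (r \<nu> + \<delta> \<nu> (grand_total N m x + 1))\<^sup>2 < 1 / r \<nu>"
    proof -
      have "r \<nu> * r \<nu> < (r \<nu> + \<delta> \<nu> (grand_total N m x + 1))\<^sup>2"
        unfolding power2_eq_square using r[OF \<nu>] \<delta>[OF \<nu>, of "grand_total N m x + 1"]
        by (intro mult_strict_mono) auto
      then show ?thesis
        using r[OF \<nu>] \<delta>[OF \<nu>, of "grand_total N m x + 1"]
        by (simp add: divide_less_eq less_divide_eq)
    qed
    then show "((\<Sum>i=1..m \<nu>. c \<nu> i * real (x \<nu> i)) + c_total m c \<nu>) *
       ((r \<nu> + real (row_total m x \<nu>)) /
          (r \<nu> + real (row_total m x \<nu>) + \<delta> \<nu> (grand_total N m x + 1))\<^sup>2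
        - 1 / (r \<nu> + real (row_total m x \<nu>)))
     + 2 * (\<Sum>i=1..m \<nu>. c \<nu> i * real (x \<nu> i)) *
       (1 / (r \<nu> + real (row_total m x \<nu>) - 1)
        - 1 / (r \<nu> + real (row_total m x \<nu>) - 1 + \<delta> \<nu> (grand_total N m x))) < 0"
      unfolding T W using C[OF \<nu>] by (simp add: mult_less_0_iff)
  qed (use n in auto)
  then show ?thesis by simp
qed

lemma delta_max_pos:
  assumes "1 \<le> n" "\<And>\<nu>. \<nu> \<in> {1..n} \<Longrightarrow> 0 < \<delta> \<nu> z"
  shows "0 < delta_max n \<delta> z"
  using assms by (auto simp: delta_max_def Max_gr_iff intro!: bexI[of _ 1])

lemma rho_bounds:
  assumes n: "1 \<le> n" and \<delta>: "\<And>\<nu> z. \<nu> \<in> {1..n} \<Longrightarrow> 0 < \<delta> \<nu> z"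
  shows "0 \<le> rho n \<delta>" "rho n \<delta> \<le> 1"
    and "2 \<le> z \<Longrightarrow> \<nu> \<in> {1..n} \<Longrightarrow> rho n \<delta> * delta_max n \<delta> z \<le> \<delta> \<nu> z"
proof -
  have pos: "0 < delta_max n \<delta> z" for z
    using delta_max_pos[OF n \<delta>] .
  have min_pos: "0 < delta_min n \<delta> z" for z
    using n \<delta> by (auto simp: delta_min_def)
  have nonneg: "0 \<le> delta_min n \<delta> z / delta_max n \<delta> z" for z
    using pos[of z] min_pos[of z] by simp
  have min_le: "delta_min n \<delta> z \<le> \<delta> \<nu> z" if "\<nu> \<in> {1..n}" for \<nu> z
    using that by (auto simp: delta_min_def intro!: Min_le)
  have le_max: "\<delta> \<nu> z \<le> delta_max n \<delta> z" if "\<nu> \<in> {1..n}" for \<nu> z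
    using that by (auto simp: delta_max_def intro!: Max_ge)
  have "bdd_below ((\<lambda>z. delta_min n \<delta> z / delta_max n \<delta> z) ` {2..})"
    using nonneg by (intro bdd_belowI[of _ 0]) auto
  then have lower: "rho n \<delta> \<le> delta_min n \<delta> z / delta_max n \<delta> z" if "2 \<le> z" for z
    unfolding rho_def using that by (intro cINF_lower) auto
  show "0 \<le> rho n \<delta>"
    unfolding rho_def using nonneg by (intro cINF_greatest) auto
  have "delta_min n \<delta> 2 \<le> delta_max n \<delta> 2"
    using min_le[of 1 2] le_max[of 1 2] n by simp
  then have "delta_min n \<delta> 2 / delta_max n \<delta> 2 \<le> 1"
    using pos[of 2] by (simp add: divide_le_eq_1)
  then show "rho n \<delta> \<le> 1"
    using lower[of 2] by simp
  show "rho n \<delta> * delta_max n \<delta> z \<le> \<delta> \<nu> z" if "2 \<le> z" "\<nu> \<in> {1..n}"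
    using lower[OF that(1)] min_le[OF that(2), of z] pos[of z] by (simp add: pos_le_divide_eq)
qed

text \<open>
The population bounds with the common constants \<open>D\<close>, \<open>C\<close> and \<open>L\<close> are added up. The grand total
is at least every population total, so that the monotonicity of \<open>z \<delta>\<^sub>\<nu>(z)\<close>, a statement about the grand
total \<open>z\<close>, gives the corresponding one with the population total \<open>t\<close> as coefficient.
\<close>

lemma unbiased_loss_le:
  assumes n: "n \<in> {1..N}" and r: "\<And>\<nu>. \<nu> \<in> {1..n} \<Longrightarrow> 5 / 2 \<le> r \<nu>"
    and m: "\<And>\<nu>. \<nu> \<in> {1..n} \<Longrightarrow> 1 \<le> m \<nu>"
    and c: "\<And>\<nu> i. \<nu> \<in> {1..n} \<Longrightarrow> i \<in> {1..m \<nu>} \<Longrightarrow> 0 \<le> c \<nu> i"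
    and cm: "3 * c_max n m c \<le> c_total_min n m c"
    and \<delta>: "\<And>\<nu> z. \<nu> \<in> {1..n} \<Longrightarrow> 0 < \<delta> \<nu> z"
    and mono: "\<And>\<nu> z. \<nu> \<in> {1..n} \<Longrightarrow> 1 \<le> z \<Longrightarrow> real z * \<delta> \<nu> z \<le> real (z + 1) * \<delta> \<nu> (z + 1)"
    and cond: "condition_i n m r c \<delta> (grand_total N m x) \<or> condition_ii n m r c \<delta> (grand_total N m x)"
    and Z: "1 \<le> grand_total N m x"
  shows "unbiased_loss n N m r c \<delta> x \<le> unbiased_loss n N m r c (\<lambda>_ _. 0) x"
proof -
  define z where "z = grand_total N m x"
  define t where "t \<nu> = real (row_total m x \<nu>)" for \<nu>
  define k where "k = c_max n m c"
  define C where "C = c_total_min n m c"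
  define D where "D = delta_max n \<delta> (z + 1)"
  define \<rho> where "\<rho> = rho n \<delta>"
  define L where "L = 2 * (C - 3 * k) * \<rho>"
  have A: "finite {1..n}" "{1..n} \<noteq> {}" and n1: "1 \<le> n"
    using n by auto
  have c_le: "c \<nu> i \<le> k" if "\<nu> \<in> {1..n}" "i \<in> {1..m \<nu>}" for \<nu> i
  proof -
    have "c \<nu> i \<le> (MAX i\<in>{1..m \<nu>}. c \<nu> i)"
      using that by (intro Max_ge) auto
    also have "\<dots> \<le> k"
      unfolding k_def c_max_def using that by (intro Max_ge) auto
    finally show ?thesis .
  qed
  have k: "0 \<le> k"
    using c_le[of 1 1] c[of 1 1] m[of 1] n1 by auto
  have C: "3 * k \<le> C"
    using cm by (simp add: k_def C_def)
  have C_le: "C \<le> c_total m c \<nu>" if "\<nu> \<in> {1..n}" for \<nu>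
    unfolding C_def c_total_min_def using that by (intro Min_le) auto
  have D: "0 < D"
    unfolding D_def by (intro delta_max_pos n1 \<delta>)
  have \<rho>: "0 \<le> \<rho>" "\<rho> \<le> 1"
    using rho_bounds[where \<delta> = \<delta>, OF n1 \<delta>] by (auto simp: \<rho>_def)
  have L: "0 \<le> L"
    using C \<rho> by (simp add: L_def)
  have rl: "r_min n r \<le> r \<nu>" "r \<nu> \<le> r_max n r" if "\<nu> \<in> {1..n}" for \<nu>
    using that by (auto simp: r_min_def r_max_def intro!: Min_le Max_ge)
  have "0 < r \<nu>" if "\<nu> \<in> {1..n}" for \<nu>
    using r[OF that] by simp
  then have rl0: "0 < r_min n r"
    unfolding r_min_def using A by (subst Min_gr_iff) auto
  have t0: "0 \<le> t \<nu>" for \<nu>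
    by (simp add: t_def)
  have t_sum: "(\<Sum>\<nu>=1..n. t \<nu>) \<le> real z"
  proof -
    have "(\<Sum>\<nu>=1..n. row_total m x \<nu>) \<le> z"
      unfolding z_def grand_total_def using n by (intro sum_mono2) auto
    then show ?thesis by (simp add: t_def flip: of_nat_sum)
  qed
  have t_le: "t \<nu> \<le> real z" if "\<nu> \<in> {1..n}" for \<nu>
    using member_le_sum[of \<nu> "{1..n}" t] t0 that t_sum by simp
  have "unbiased_loss n N m r c \<delta> x - unbiased_loss n N m r c (\<lambda>_ _. 0) x \<le>
      (\<Sum>\<nu>=1..n. D / ((r \<nu> + t \<nu>) * (r \<nu> + t \<nu> + D)\<^sup>2)
            * ((k * t \<nu> + C) * D - L * (r \<nu> + t \<nu> + D)))"
  proof (subst unbiased_loss_difference, goal_cases)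
    case (1 \<nu>)
    then show ?case using r[of \<nu>] by simp
  next
    case 2
    show ?case
    proof (intro sum_mono, unfold Let_def t_def[symmetric] z_def[symmetric])
      fix \<nu> assume \<nu>: "\<nu> \<in> {1..n}"
      define W where "W = (\<Sum>i=1..m \<nu>. c \<nu> i * real (x \<nu> i))"
      have W0: "0 \<le> W"
        unfolding W_def using c[OF \<nu>] by (intro sum_nonneg mult_nonneg_nonneg) auto
      have "W \<le> (\<Sum>i=1..m \<nu>. k * real (x \<nu> i))"
        unfolding W_def using c_le[OF \<nu>] by (intro sum_mono mult_right_mono) auto
      then have W: "W \<le> k * t \<nu>"
        by (simp add: t_def row_total_def sum_distrib_left)
      have a: "t \<nu> + 5 / 2 \<le> r \<nu> + t \<nu>"
        using r[OF \<nu>] by simp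
      have z: "1 \<le> z" using Z by (simp add: z_def)
      \<comment> \<open>Uses \<open>t / z \<le> 1\<close>, after writing \<open>t\<close> as \<open>(t / z) * z\<close>.\<close>
      have step: "t \<nu> * \<delta> \<nu> z \<le> (t \<nu> + 1) * \<delta> \<nu> (z + 1)"
      proof -
        have "t \<nu> * \<delta> \<nu> z = t \<nu> / real z * (real z * \<delta> \<nu> z)"
          using z by simp
        also have "\<dots> \<le> t \<nu> / real z * (real (z + 1) * \<delta> \<nu> (z + 1))"
          using mono[OF \<nu> z] t0[of \<nu>] by (intro mult_left_mono) auto
        also have "\<dots> = (t \<nu> + t \<nu> / real z) * \<delta> \<nu> (z + 1)"
          using z by (simp add: field_simps)
        also have "\<dots> \<le> (t \<nu> + 1) * \<delta> \<nu> (z + 1)"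
          using t_le[OF \<nu>] z \<delta>[OF \<nu>, of "z + 1"] by (intro mult_right_mono) auto
        finally show ?thesis .
      qed
      have "\<delta> \<nu> (z + 1) \<le> D"
        unfolding D_def delta_max_def using \<nu> by (intro Max_ge) auto
      moreover have "\<rho> * D \<le> \<delta> \<nu> (z + 1)"
        unfolding D_def \<rho>_def using z \<nu> by (intro rho_bounds n1 \<delta>) auto
      moreover have "0 < r \<nu> + t \<nu>"
        using r[OF \<nu>] t0[of \<nu>] by linarith
      ultimately show "(W + c_total m c \<nu>)
            * ((r \<nu> + t \<nu>) / (r \<nu> + t \<nu> + \<delta> \<nu> (z + 1))\<^sup>2 - 1 / (r \<nu> + t \<nu>))
          + 2 * W * (1 / (r \<nu> + t \<nu> - 1) - 1 / (r \<nu> + t \<nu> - 1 + \<delta> \<nu> z))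
        \<le> D / ((r \<nu> + t \<nu>) * (r \<nu> + t \<nu> + D)\<^sup>2) * ((k * t \<nu> + C) * D - L * (r \<nu> + t \<nu> + D))"
        using order_trans[OF population_difference_le[OF t0 a \<delta>[OF \<nu>] \<delta>[OF \<nu>] step W0 W k]
            population_bound_uniform[OF t0 _ k \<delta>[OF \<nu>] _ _ \<rho> C_le[OF \<nu>] C]]
        unfolding L_def by blast
    qed
  qed
  also have "\<dots> \<le> 0"
    using cond unfolding z_def[symmetric]
  proof
    assume "condition_i n m r c \<delta> z"
    moreover have "2 * \<kappa> * (C - 3 * k) * \<rho> = \<kappa> * L"
      and "2 * r_min n r * \<kappa> * (C - 3 * k) * \<rho> = r_min n r * (\<kappa> * L)" for \<kappa>
      by (simp_all add: L_def)
    ultimately show ?thesis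
      unfolding condition_i_def Let_def k_def[symmetric] C_def[symmetric] \<rho>_def[symmetric]
        D_def[symmetric]
      by (intro bound_sum_nonpos_i[OF A rl rl0 t0 t_sum D k _ L]) (use C k in auto)
  next
    assume "condition_ii n m r c \<delta> z"
    from this[unfolded condition_ii_def Let_def, folded k_def C_def \<rho>_def D_def, folded L_def]
    show ?thesis
      by (intro bound_sum_nonpos_ii[OF A rl(1) rl0 t0 t_sum D k]) auto
  qed
  finally show ?thesis by simp
qed

section \<open>The joint law of the observations\<close>

text \<open>
Arrays that take the value \<open>undefined\<close> outside the index range: each observation has exactly one such
representative, so the data form a countable set on which the law is given by point masses.
\<close>

definition count_arrays :: "nat \<Rightarrow> (nat \<Rightarrow> nat) \<Rightarrow> counts set" where
  "count_arrays N m = (\<Pi>\<^sub>E \<nu>\<in>{1..N}. \<Pi>\<^sub>E i\<in>{1..m \<nu>}. UNIV)"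

definition restrict_counts :: "nat \<Rightarrow> (nat \<Rightarrow> nat) \<Rightarrow> counts \<Rightarrow> counts" where
  "restrict_counts N m x = (\<lambda>\<nu>\<in>{1..N}. \<lambda>i\<in>{1..m \<nu>}. x \<nu> i)"

definition increment :: "nat \<Rightarrow> nat \<Rightarrow> counts \<Rightarrow> counts" where
  "increment \<nu> i x = x(\<nu> := (x \<nu>)(i := Suc (x \<nu> i)))"

lemma countable_count_arrays: "countable (count_arrays N m)"
  unfolding count_arrays_def by (intro countable_PiE) auto

lemma row_total_restrict_counts:
  "\<nu> \<in> {1..N} \<Longrightarrow> row_total m (restrict_counts N m x) \<nu> = row_total m x \<nu>"
  by (simp add: row_total_def restrict_counts_def)

lemma loss_shrinkage_restrict_counts:
  assumes "n \<in> {1..N}"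
  shows "loss n m c (shrinkage_estimator N m r \<delta> (restrict_counts N m x)) p
       = loss n m c (shrinkage_estimator N m r \<delta> x) p"
proof -
  have "grand_total N m (restrict_counts N m x) = grand_total N m x"
    unfolding grand_total_def by (intro sum.cong row_total_restrict_counts) auto
  moreover have "\<nu> \<in> {1..N}" if "\<nu> \<in> {1..n}" for \<nu>
    using that assms by auto
  ultimately show ?thesis
    unfolding loss_def shrinkage_estimator_def
    by (intro sum.cong) (auto simp: row_total_restrict_counts, simp add: restrict_counts_def)
qed

text \<open>
Independence gives the probability of each single array as a product of masses; as there are only
countably many arrays, these probabilities determine the law.
\<close>

lemma observations_law:
  assumes obs: "neg_multinomial_observations N m r p M X" and N: "1 \<le> N"
  obtains Q :: "counts pmf"
  where "(\<lambda>\<omega>. restrict_counts N m (\<lambda>\<nu> i. X \<nu> i \<omega>)) \<in> M \<rightarrow>\<^sub>M count_space UNIV"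
    and "distr M (count_space UNIV) (\<lambda>\<omega>. restrict_counts N m (\<lambda>\<nu> i. X \<nu> i \<omega>)) = measure_pmf Q"
    and "\<And>x. x \<in> count_arrays N m \<Longrightarrow>
           pmf Q x = (\<Prod>\<nu>=1..N. neg_multinomial_mass (m \<nu>) (r \<nu>) (p \<nu>) (x \<nu>))"
    and "\<And>x. x \<notin> count_arrays N m \<Longrightarrow> pmf Q x = 0"
proof -
  define Y where "Y \<omega> = restrict_counts N m (\<lambda>\<nu> i. X \<nu> i \<omega>)" for \<omega>
  define R where "R \<nu> \<omega> = (\<lambda>i\<in>{1..m \<nu>}. X \<nu> i \<omega>)" for \<nu> \<omega>
  interpret prob_space M
    using obs by (simp add: neg_multinomial_observations_def)
  have indep: "indep_vars (\<lambda>\<nu>. \<Pi>\<^sub>M i\<in>{1..m \<nu>}. count_space UNIV) R {1..N}"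
    using obs unfolding neg_multinomial_observations_def R_def by blast
  have R_meas: "R \<nu> \<in> M \<rightarrow>\<^sub>M (\<Pi>\<^sub>M i\<in>{1..m \<nu>}. count_space UNIV)" if "\<nu> \<in> {1..N}" for \<nu>
    using indep that by (auto simp: indep_vars_def)
  have mass: "prob {\<omega> \<in> space M. \<forall>i\<in>{1..m \<nu>}. X \<nu> i \<omega> = x i}
      = neg_multinomial_mass (m \<nu>) (r \<nu>) (p \<nu>) x" if "\<nu> \<in> {1..N}" for \<nu> x
    using obs that by (simp add: neg_multinomial_observations_def)
  have Y_range: "Y \<omega> \<in> count_arrays N m" for \<omega>
    by (auto simp: Y_def restrict_counts_def count_arrays_def)
  have singleton: "{y} \<in> sets (\<Pi>\<^sub>M i\<in>{1..m \<nu>}. count_space UNIV)"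
    if "y \<in> (\<Pi>\<^sub>E i\<in>{1..m \<nu>}. UNIV)" for \<nu> and y :: "nat \<Rightarrow> nat"
  proof -
    have "{y} = (\<Pi>\<^sub>E i\<in>{1..m \<nu>}. {y i})"
      using that by (auto simp: PiE_def extensional_def fun_eq_iff Pi_def) metis
    also have "\<dots> \<in> sets (\<Pi>\<^sub>M i\<in>{1..m \<nu>}. count_space UNIV)"
      by (intro sets_PiM_I_finite) auto
    finally show ?thesis .
  qed
  have row: "x \<nu> \<in> (\<Pi>\<^sub>E i\<in>{1..m \<nu>}. UNIV)" if "x \<in> count_arrays N m" "\<nu> \<in> {1..N}" for x \<nu>
    using that unfolding count_arrays_def by (rule PiE_mem)
  have Y_fibre: "Y -` {x} \<inter> space M = (\<Inter>\<nu>\<in>{1..N}. R \<nu> -` {x \<nu>} \<inter> space M)"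
    if "x \<in> count_arrays N m" for x
  proof -
    have "Y \<omega> = x \<longleftrightarrow> (\<forall>\<nu>\<in>{1..N}. R \<nu> \<omega> = x \<nu>)" for \<omega>
    proof -
      have "Y \<omega> = (\<lambda>\<nu>\<in>{1..N}. R \<nu> \<omega>)"
        by (simp add: Y_def R_def restrict_counts_def)
      moreover have "x = (\<lambda>\<nu>\<in>{1..N}. x \<nu>)"
        using that unfolding count_arrays_def by (metis PiE_restrict)
      ultimately show ?thesis
        by (metis restrict_apply' restrict_ext)
    qed
    then show ?thesis using N by auto
  qed
  have Y_meas: "Y \<in> M \<rightarrow>\<^sub>M count_space UNIV"
  proof (rule measurable_compose[where g = "\<lambda>y. y"])
    show "Y \<in> M \<rightarrow>\<^sub>M count_space (count_arrays N m)"
      unfolding measurable_count_space_eq_countable[OF countable_count_arrays]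
    proof (intro conjI ballI)
      fix x assume x: "x \<in> count_arrays N m"
      show "Y -` {x} \<inter> space M \<in> sets M"
        unfolding Y_fibre[OF x] using N R_meas singleton[OF row[OF x]]
        by (intro sets.finite_INT) (auto intro!: measurable_sets)
    qed (use Y_range in auto)
  qed simp
  define Dm where "Dm = distr M (count_space UNIV) Y"
  interpret D: prob_space Dm
    unfolding Dm_def by (rule prob_space_distr[OF Y_meas])
  have sets_D: "sets Dm = UNIV"
    by (simp add: Dm_def)
  have AE_D: "AE x in Dm. x \<in> count_arrays N m"
    unfolding Dm_def using Y_range by (subst AE_distr_iff[OF Y_meas]) auto
  then have "AE x in Dm. measure Dm {x} \<noteq> 0"
    using D.AE_support_countable[OF sets_D] countable_count_arrays by blast
  then have Q: "measure_pmf (Abs_pmf Dm) = Dm"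
    using sets_D D.prob_space_axioms by (intro Abs_pmf_inverse) auto
  have pmf_Q: "pmf (Abs_pmf Dm) x = prob (Y -` {x} \<inter> space M)" for x
    unfolding pmf.rep_eq Q by (simp add: Dm_def measure_distr[OF Y_meas])
  show ?thesis
  proof (rule that)
    show "(\<lambda>\<omega>. restrict_counts N m (\<lambda>\<nu> i. X \<nu> i \<omega>)) \<in> M \<rightarrow>\<^sub>M count_space UNIV"
      using Y_meas by (simp add: Y_def[abs_def])
    show "distr M (count_space UNIV) (\<lambda>\<omega>. restrict_counts N m (\<lambda>\<nu> i. X \<nu> i \<omega>))
        = measure_pmf (Abs_pmf Dm)"
      unfolding Q by (simp add: Dm_def Y_def[abs_def])
  next
    fix x assume x: "x \<in> count_arrays N m"
    have "pmf (Abs_pmf Dm) x = (\<Prod>\<nu>=1..N. prob (R \<nu> -` {x \<nu>} \<inter> space M))"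
      unfolding pmf_Q Y_fibre[OF x] using N singleton[OF row[OF x]]
      by (intro indep_varsD[OF indep]) auto
    also have "\<dots> = (\<Prod>\<nu>=1..N. neg_multinomial_mass (m \<nu>) (r \<nu>) (p \<nu>) (x \<nu>))"
    proof (intro prod.cong refl)
      fix \<nu> assume \<nu>: "\<nu> \<in> {1..N}"
      have "R \<nu> \<omega> = x \<nu> \<longleftrightarrow> (\<forall>i\<in>{1..m \<nu>}. X \<nu> i \<omega> = x \<nu> i)" for \<omega>
      proof -
        have "x \<nu> = (\<lambda>i\<in>{1..m \<nu>}. x \<nu> i)"
          using row[OF x \<nu>] by (metis PiE_restrict)
        then show ?thesis
          unfolding R_def by (metis restrict_apply' restrict_ext)
      qed
      then have "R \<nu> -` {x \<nu>} \<inter> space M = {\<omega> \<in> space M. \<forall>i\<in>{1..m \<nu>}. X \<nu> i \<omega> = x \<nu> i}"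
        by auto
      then show "prob (R \<nu> -` {x \<nu>} \<inter> space M) = neg_multinomial_mass (m \<nu>) (r \<nu>) (p \<nu>) (x \<nu>)"
        using mass[OF \<nu>] by simp
    qed
    finally show "pmf (Abs_pmf Dm) x
        = (\<Prod>\<nu>=1..N. neg_multinomial_mass (m \<nu>) (r \<nu>) (p \<nu>) (x \<nu>))" .
  next
    fix x assume "x \<notin> count_arrays N m"
    then have "Y -` {x} \<inter> space M = {}"
      using Y_range by auto
    then show "pmf (Abs_pmf Dm) x = 0"
      unfolding pmf_Q by simp
  qed
qed

section \<open>Unbiased estimation of the risk\<close>

text \<open>
Moving from \<open>x\<close> to \<open>x + e\<^sub>i\<close> changes one Gamma factor, one factorial and one power of \<open>q i\<close>. This
recursion of the masses is the only property of the distribution that enters the risk calculation.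
\<close>

lemma neg_multinomial_mass_increment:
  assumes i: "i \<in> {1..k}" and s: "0 < s"
  shows "(real (x i) + 1) * neg_multinomial_mass k s q (x(i := Suc (x i)))
       = q i * (s + real (\<Sum>j=1..k. x j)) * neg_multinomial_mass k s q x"
proof -
  define y where "y = x(i := Suc (x i))"
  define t where "t = (\<Sum>j=1..k. x j)"
  have y: "y i = Suc (x i)" "\<And>j. j \<in> {1..k} - {i} \<Longrightarrow> y j = x j"
    by (auto simp: y_def)
  have "(\<Sum>j=1..k. y j) = Suc t"
    unfolding t_def using i by (simp add: sum.remove[of _ i] y)
  moreover have "(\<Prod>j=1..k. fact (y j) :: real) = (real (x i) + 1) * (\<Prod>j=1..k. fact (x j))"
    using i by (simp add: prod.remove[of _ i] y algebra_simps)
  moreover have "(\<Prod>j=1..k. q j ^ y j) = q i * (\<Prod>j=1..k. q j ^ x j)"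
    using i by (simp add: prod.remove[of _ i] y)
  moreover have "Gamma (s + real (Suc t)) = (s + real t) * Gamma (s + real t)"
    using s Gamma_plus1[of "s + real t"] by (simp add: add_ac nonpos_Ints_def)
  moreover have "(\<Prod>j=1..k. fact (x j) :: real) \<noteq> 0"
    by simp
  moreover have "Gamma s \<noteq> 0"
    using s by (simp add: Gamma_real_pos less_imp_neq[symmetric])
  ultimately show ?thesis
    unfolding neg_multinomial_mass_def y_def[symmetric] t_def[symmetric]
    by (simp add: divide_simps add_nonneg_eq_0_iff mult_ac)
qed

lemma increment_in_count_arrays_iff:
  assumes "\<nu> \<in> {1..N}" "i \<in> {1..m \<nu>}"
  shows "increment \<nu> i x \<in> count_arrays N m \<longleftrightarrow> x \<in> count_arrays N m"
  using assms unfolding count_arrays_def increment_def PiE_iff extensional_def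
  by (auto split: if_splits)

lemma row_total_increment:
  assumes "i \<in> {1..m \<nu>}"
  shows "row_total m (increment \<nu> i x) \<nu> = Suc (row_total m x \<nu>)"
proof -
  have "(\<Sum>j\<in>{1..m \<nu>} - {i}. increment \<nu> i x \<nu> j) = (\<Sum>j\<in>{1..m \<nu>} - {i}. x \<nu> j)"
    by (intro sum.cong) (auto simp: increment_def)
  then show ?thesis
    using assms by (simp add: row_total_def sum.remove[of _ i]) (simp add: increment_def)
qed

lemma grand_total_increment:
  assumes "\<nu> \<in> {1..N}" "i \<in> {1..m \<nu>}"
  shows "grand_total N m (increment \<nu> i x) = Suc (grand_total N m x)"
proof -
  have "(\<Sum>\<mu>\<in>{1..N} - {\<nu>}. row_total m (increment \<nu> i x) \<mu>)
      = (\<Sum>\<mu>\<in>{1..N} - {\<nu>}. row_total m x \<mu>)"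
    by (intro sum.cong) (auto simp: increment_def row_total_def)
  then show ?thesis
    using assms row_total_increment[where m=m, OF assms(2)]
    by (simp add: grand_total_def sum.remove[of _ \<nu>])
qed

lemma bij_increment: "bij_betw (increment \<nu> i) UNIV {x. 0 < x \<nu> i}"
proof (rule bij_betw_byWitness[where f' = "\<lambda>x. x(\<nu> := (x \<nu>)(i := x \<nu> i - 1))"])
  show "\<forall>x\<in>UNIV. (increment \<nu> i x)(\<nu> := (increment \<nu> i x \<nu>)(i := increment \<nu> i x \<nu> i - 1)) = x"
    by (auto simp: increment_def fun_eq_iff)
  show "\<forall>x\<in>{x. 0 < x \<nu> i}. increment \<nu> i (x(\<nu> := (x \<nu>)(i := x \<nu> i - 1))) = x"
    by (auto simp: increment_def fun_eq_iff)
qed (auto simp: increment_def)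

lemma pmf_increment:
  assumes law: "\<And>x. x \<in> count_arrays N m \<Longrightarrow>
      pmf Q x = (\<Prod>\<nu>=1..N. neg_multinomial_mass (m \<nu>) (r \<nu>) (p \<nu>) (x \<nu>))"
    and null: "\<And>x. x \<notin> count_arrays N m \<Longrightarrow> pmf Q x = 0"
    and \<nu>: "\<nu> \<in> {1..N}" and i: "i \<in> {1..m \<nu>}" and r: "0 < r \<nu>"
  shows "(real (x \<nu> i) + 1) * pmf Q (increment \<nu> i x)
       = p \<nu> i * (r \<nu> + real (row_total m x \<nu>)) * pmf Q x"
proof (cases "x \<in> count_arrays N m")
  case False
  then show ?thesis
    using null[of x] null[of "increment \<nu> i x"] increment_in_count_arrays_iff[where m=m, OF \<nu> i] by simp
next
  case True
  define g where "g \<mu> y = neg_multinomial_mass (m \<mu>) (r \<mu>) (p \<mu>) y" for \<mu> and y :: "nat \<Rightarrow> nat"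
  have "pmf Q (increment \<nu> i x) = (\<Prod>\<mu>=1..N. g \<mu> (increment \<nu> i x \<mu>))"
    using law[of "increment \<nu> i x"] True increment_in_count_arrays_iff[where m=m, OF \<nu> i]
    by (simp add: g_def)
  also have "\<dots> = g \<nu> ((x \<nu>)(i := Suc (x \<nu> i))) * (\<Prod>\<mu>\<in>{1..N} - {\<nu>}. g \<mu> (x \<mu>))"
    using \<nu> by (simp add: prod.remove[of _ \<nu>] increment_def)
  finally have "(real (x \<nu> i) + 1) * pmf Q (increment \<nu> i x)
      = (real (x \<nu> i) + 1) * g \<nu> ((x \<nu>)(i := Suc (x \<nu> i))) * (\<Prod>\<mu>\<in>{1..N} - {\<nu>}. g \<mu> (x \<mu>))"
    by simp
  also have "\<dots> = p \<nu> i * (r \<nu> + real (row_total m x \<nu>))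
      * (g \<nu> (x \<nu>) * (\<Prod>\<mu>\<in>{1..N} - {\<nu>}. g \<mu> (x \<mu>)))"
    unfolding g_def neg_multinomial_mass_increment[OF i r] by (simp add: row_total_def)
  also have "g \<nu> (x \<nu>) * (\<Prod>\<mu>\<in>{1..N} - {\<nu>}. g \<mu> (x \<mu>)) = pmf Q x"
    using \<nu> law[OF True] by (simp add: prod.remove[of _ \<nu>] g_def)
  finally show ?thesis .
qed

text \<open>
The negative multinomial counterpart of Stein's identity, obtained from the recursion of the
masses by summation over all arrays with positive entry at \<open>(\<nu>, i)\<close>. It serves to remove the
factor \<open>1 / p\<^sub>i\<close> of the standardized loss from an expectation.
\<close>

lemma expectation_increment:
  fixes h :: "counts \<Rightarrow> real"
  assumes law: "\<And>x. x \<in> count_arrays N m \<Longrightarrow>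
      pmf Q x = (\<Prod>\<nu>=1..N. neg_multinomial_mass (m \<nu>) (r \<nu>) (p \<nu>) (x \<nu>))"
    and null: "\<And>x. x \<notin> count_arrays N m \<Longrightarrow> pmf Q x = 0"
    and \<nu>: "\<nu> \<in> {1..N}" and i: "i \<in> {1..m \<nu>}" and r: "0 < r \<nu>"
    and h: "\<And>x. x \<nu> i = 0 \<Longrightarrow> h x = 0"
  shows "measure_pmf.expectation Q h = p \<nu> i * measure_pmf.expectation Q
           (\<lambda>x. (r \<nu> + real (row_total m x \<nu>)) / (real (x \<nu> i) + 1) * h (increment \<nu> i x))"
proof -
  have expectation_eq: "measure_pmf.expectation Q g = (\<integral>x. pmf Q x * g x \<partial>count_space UNIV)"
    for g :: "counts \<Rightarrow> real"
    by (simp add: measure_pmf_eq_density integral_density)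
  have "measure_pmf.expectation Q h
      = (\<integral>x. indicator {x. 0 < x \<nu> i} x *\<^sub>R (pmf Q x * h x) \<partial>count_space UNIV)"
    unfolding expectation_eq
    by (intro Bochner_Integration.integral_cong) (auto simp: h split: split_indicator)
  also have "\<dots> = (\<integral>x. pmf Q x * h x \<partial>count_space {x. 0 < x \<nu> i})"
    using integral_restrict_space[where M = "count_space UNIV" and \<Omega> = "{x. 0 < x \<nu> i}"
        and f = "\<lambda>x. pmf Q x * h x"]
    by (simp add: restrict_count_space)
  also have "\<dots> = (\<integral>x. pmf Q (increment \<nu> i x) * h (increment \<nu> i x) \<partial>count_space UNIV)"
    using integral_bij_count_space[OF bij_increment, of "\<lambda>x. pmf Q x * h x"] by simp
  also have "\<dots> = (\<integral>x. p \<nu> i * (pmf Q x *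
      ((r \<nu> + real (row_total m x \<nu>)) / (real (x \<nu> i) + 1) * h (increment \<nu> i x))) \<partial>count_space UNIV)"
  proof (intro Bochner_Integration.integral_cong refl)
    fix x
    have *: "(real (x \<nu> i) + 1) * pmf Q (increment \<nu> i x)
        = p \<nu> i * (r \<nu> + real (row_total m x \<nu>)) * pmf Q x"
      by (rule pmf_increment[OF law null \<nu> i r])
    have "pmf Q (increment \<nu> i x) = (real (x \<nu> i) + 1) * pmf Q (increment \<nu> i x) / (real (x \<nu> i) + 1)"
      by simp
    also have "\<dots> = p \<nu> i * (r \<nu> + real (row_total m x \<nu>)) * pmf Q x / (real (x \<nu> i) + 1)"
      by (simp only: *)
    finally show "pmf Q (increment \<nu> i x) * h (increment \<nu> i x) = p \<nu> i * (pmf Q x *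
      ((r \<nu> + real (row_total m x \<nu>)) / (real (x \<nu> i) + 1) * h (increment \<nu> i x)))"
      by simp
  qed
  also have "\<dots> = p \<nu> i * measure_pmf.expectation Q
      (\<lambda>x. (r \<nu> + real (row_total m x \<nu>)) / (real (x \<nu> i) + 1) * h (increment \<nu> i x))"
    unfolding expectation_eq by (rule integral_mult_right_zero)
  finally show ?thesis .
qed

lemma count_le_row_total: "i \<in> {1..m \<nu>} \<Longrightarrow> x \<nu> i \<le> row_total m x \<nu>"
  unfolding row_total_def by (rule member_le_sum) auto

lemma shrinkage_estimator_bounds:
  assumes "i \<in> {1..m \<nu>}" "1 \<le> r \<nu>" "\<And>z. 0 \<le> \<delta> \<nu> z"
  shows "0 \<le> shrinkage_estimator N m r \<delta> x \<nu> i" "shrinkage_estimator N m r \<delta> x \<nu> i \<le> 1"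
proof -
  have "real (x \<nu> i) \<le> real (row_total m x \<nu>)"
    using count_le_row_total[where m=m, OF assms(1)] by simp
  then have "real (x \<nu> i) \<le> r \<nu> + real (row_total m x \<nu>) - 1 + \<delta> \<nu> (grand_total N m x)"
    using assms(2) assms(3)[of "grand_total N m x"] by linarith
  then show "0 \<le> shrinkage_estimator N m r \<delta> x \<nu> i" "shrinkage_estimator N m r \<delta> x \<nu> i \<le> 1"
    unfolding shrinkage_estimator_def by (auto simp: divide_le_eq_1)
qed

text \<open>
Expanding \<open>(S - p)\<^sup>2 / p = S\<^sup>2 / p - 2 * S + p\<close>, only the first term has the parameter in it in an
essential way, and \<open>expectation_increment\<close> applies to it since \<open>S\<^sup>2\<close> vanishes with the count. All
quantities are bounded by \<open>1\<close>, whence the integrability.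
\<close>

lemma expectation_loss:
  assumes law: "\<And>x. x \<in> count_arrays N m \<Longrightarrow>
      pmf Q x = (\<Prod>\<nu>=1..N. neg_multinomial_mass (m \<nu>) (r \<nu>) (p \<nu>) (x \<nu>))"
    and null: "\<And>x. x \<notin> count_arrays N m \<Longrightarrow> pmf Q x = 0"
    and n: "n \<in> {1..N}"
    and p: "\<And>\<nu> i. \<nu> \<in> {1..n} \<Longrightarrow> i \<in> {1..m \<nu>} \<Longrightarrow> 0 < p \<nu> i"
    and r: "\<And>\<nu>. \<nu> \<in> {1..n} \<Longrightarrow> 1 \<le> r \<nu>"
    and \<delta>: "\<And>\<nu> z. \<nu> \<in> {1..n} \<Longrightarrow> 0 \<le> \<delta> \<nu> z"
  shows "integrable (measure_pmf Q) (\<lambda>x. loss n m c (shrinkage_estimator N m r \<delta> x) p)"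
    and "integrable (measure_pmf Q) (unbiased_loss n N m r c \<delta>)"
    and "measure_pmf.expectation Q (\<lambda>x. loss n m c (shrinkage_estimator N m r \<delta> x) p)
         = measure_pmf.expectation Q (unbiased_loss n N m r c \<delta>) + (\<Sum>\<nu>=1..n. \<Sum>i=1..m \<nu>. c \<nu> i * p \<nu> i)"
proof -
  define S where "S \<nu> i x = shrinkage_estimator N m r \<delta> x \<nu> i" for \<nu> i x
  define V where "V \<nu> i x = (r \<nu> + real (row_total m x \<nu>)) * (real (x \<nu> i) + 1)
      / (r \<nu> + real (row_total m x \<nu>) + \<delta> \<nu> (grand_total N m x + 1))\<^sup>2" for \<nu> i x
  have loss_eq: "loss n m c (shrinkage_estimator N m r \<delta> x) p
      = (\<Sum>\<nu>=1..n. \<Sum>i=1..m \<nu>. c \<nu> i * ((S \<nu> i x)\<^sup>2 / p \<nu> i - 2 * S \<nu> i x + p \<nu> i))" for x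
    unfolding loss_def S_def[symmetric]
  proof (intro sum.cong refl)
    fix \<nu> i assume "\<nu> \<in> {1..n}" "i \<in> {1..m \<nu>}"
    from p[OF this] show "c \<nu> i * ((S \<nu> i x - p \<nu> i)\<^sup>2 / p \<nu> i)
        = c \<nu> i * ((S \<nu> i x)\<^sup>2 / p \<nu> i - 2 * S \<nu> i x + p \<nu> i)"
      by (simp add: power2_diff field_simps power2_eq_square)
  qed
  have unbiased_eq: "unbiased_loss n N m r c \<delta> x
      = (\<Sum>\<nu>=1..n. \<Sum>i=1..m \<nu>. c \<nu> i * (V \<nu> i x - 2 * S \<nu> i x))" for x
    unfolding unbiased_loss_def V_def S_def shrinkage_estimator_def by simp
  have int_S: "integrable Q (S \<nu> i)" and int_S2: "integrable Q (\<lambda>x. (S \<nu> i x)\<^sup>2)"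
    and int_V: "integrable Q (V \<nu> i)"
    and expectation_V: "measure_pmf.expectation Q (\<lambda>x. (S \<nu> i x)\<^sup>2) = p \<nu> i * measure_pmf.expectation Q (V \<nu> i)"
    if \<nu>: "\<nu> \<in> {1..n}" and i: "i \<in> {1..m \<nu>}" for \<nu> i
  proof -
    have bounds: "0 \<le> S \<nu> i x" "S \<nu> i x \<le> 1" for x
      unfolding S_def using shrinkage_estimator_bounds[where m=m and r=r and \<delta>=\<delta>, OF i r[OF \<nu>] \<delta>[OF \<nu>]] by auto
    then show "integrable Q (S \<nu> i)" "integrable Q (\<lambda>x. (S \<nu> i x)\<^sup>2)"
      by (auto intro!: measure_pmf.integrable_const_bound[where B = 1] simp: power_le_one)
    have V_bounds: "0 \<le> V \<nu> i x \<and> V \<nu> i x \<le> 1" for x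
    proof -
      define a where "a = r \<nu> + real (row_total m x \<nu>)"
      define d where "d = \<delta> \<nu> (grand_total N m x + 1)"
      have a: "real (x \<nu> i) + 1 \<le> a" "0 < a" and d: "0 \<le> d"
        using r[OF \<nu>] count_le_row_total[where m=m and x=x, OF i] \<delta>[OF \<nu>] by (auto simp: a_def d_def)
      have "a * (real (x \<nu> i) + 1) \<le> (a + d) * (a + d)"
        using a d by (intro mult_mono) auto
      then have "a * (real (x \<nu> i) + 1) / (a + d)\<^sup>2 \<le> 1" "0 \<le> a * (real (x \<nu> i) + 1) / (a + d)\<^sup>2"
        using a d by (auto simp: power2_eq_square divide_le_eq_1)
      then show ?thesis by (simp add: V_def a_def d_def)
    qed
    then show "integrable Q (V \<nu> i)"
      by (auto intro!: measure_pmf.integrable_const_bound[where B = 1])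
    have \<nu>N: "\<nu> \<in> {1..N}" and r0: "0 < r \<nu>"
      using \<nu> n r[OF \<nu>] by auto
    have "measure_pmf.expectation Q (\<lambda>x. (S \<nu> i x)\<^sup>2) = p \<nu> i * measure_pmf.expectation Q
           (\<lambda>x. (r \<nu> + real (row_total m x \<nu>)) / (real (x \<nu> i) + 1) * (S \<nu> i (increment \<nu> i x))\<^sup>2)"
      by (rule expectation_increment[where r=r and p=p, OF law null \<nu>N i r0])
         (auto simp: S_def shrinkage_estimator_def)
    also have "(\<lambda>x. (r \<nu> + real (row_total m x \<nu>)) / (real (x \<nu> i) + 1) * (S \<nu> i (increment \<nu> i x))\<^sup>2) = V \<nu> i"
    proof
      fix x
      have "S \<nu> i (increment \<nu> i x) = (real (x \<nu> i) + 1)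
          / (r \<nu> + real (row_total m x \<nu>) + \<delta> \<nu> (grand_total N m x + 1))"
        unfolding S_def shrinkage_estimator_def row_total_increment[where m=m, OF i]
          grand_total_increment[where m=m, OF \<nu>N i]
        by (simp add: increment_def)
      then show "(r \<nu> + real (row_total m x \<nu>)) / (real (x \<nu> i) + 1) * (S \<nu> i (increment \<nu> i x))\<^sup>2 = V \<nu> i x"
        by (simp add: V_def power_divide) (simp add: power2_eq_square)
    qed
    finally show "measure_pmf.expectation Q (\<lambda>x. (S \<nu> i x)\<^sup>2) = p \<nu> i * measure_pmf.expectation Q (V \<nu> i)" .
  qed
  show "integrable (measure_pmf Q) (\<lambda>x. loss n m c (shrinkage_estimator N m r \<delta> x) p)"
    unfolding loss_eq using int_S int_S2 by (intro Bochner_Integration.integrable_sum) auto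
  show "integrable (measure_pmf Q) (unbiased_loss n N m r c \<delta>)"
    unfolding unbiased_eq[abs_def] using int_S int_V by (intro Bochner_Integration.integrable_sum) auto
  have "measure_pmf.expectation Q (\<lambda>x. loss n m c (shrinkage_estimator N m r \<delta> x) p)
      = (\<Sum>\<nu>=1..n. \<Sum>i=1..m \<nu>. c \<nu> i * (measure_pmf.expectation Q (\<lambda>x. (S \<nu> i x)\<^sup>2) / p \<nu> i
           - 2 * measure_pmf.expectation Q (S \<nu> i) + p \<nu> i))"
    unfolding loss_eq using int_S int_S2
    by (subst Bochner_Integration.integral_sum;
        (intro sum.cong refl Bochner_Integration.integrable_sum Bochner_Integration.integral_sum)?) auto
  also have "\<dots> = (\<Sum>\<nu>=1..n. \<Sum>i=1..m \<nu>. c \<nu> i * (measure_pmf.expectation Q (V \<nu> i)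
           - 2 * measure_pmf.expectation Q (S \<nu> i))) + (\<Sum>\<nu>=1..n. \<Sum>i=1..m \<nu>. c \<nu> i * p \<nu> i)"
    unfolding sum.distrib[symmetric]
  proof (intro sum.cong refl)
    fix \<nu> i assume \<nu>: "\<nu> \<in> {1..n}" and i: "i \<in> {1..m \<nu>}"
    show "c \<nu> i * (measure_pmf.expectation Q (\<lambda>x. (S \<nu> i x)\<^sup>2) / p \<nu> i
           - 2 * measure_pmf.expectation Q (S \<nu> i) + p \<nu> i)
        = c \<nu> i * (measure_pmf.expectation Q (V \<nu> i) - 2 * measure_pmf.expectation Q (S \<nu> i))
          + c \<nu> i * p \<nu> i"
      unfolding expectation_V[OF \<nu> i] using p[OF \<nu> i] by (simp add: distrib_left)
  qed
  also have "(\<Sum>\<nu>=1..n. \<Sum>i=1..m \<nu>. c \<nu> i * (measure_pmf.expectation Q (V \<nu> i)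
           - 2 * measure_pmf.expectation Q (S \<nu> i)))
      = measure_pmf.expectation Q (unbiased_loss n N m r c \<delta>)"
    unfolding unbiased_eq[abs_def] using int_S int_V
    by (subst Bochner_Integration.integral_sum;
        (intro sum.cong refl Bochner_Integration.integrable_sum Bochner_Integration.integral_sum)?) auto
  finally show "measure_pmf.expectation Q (\<lambda>x. loss n m c (shrinkage_estimator N m r \<delta> x) p)
         = measure_pmf.expectation Q (unbiased_loss n N m r c \<delta>) + (\<Sum>\<nu>=1..n. \<Sum>i=1..m \<nu>. c \<nu> i * p \<nu> i)" .
qed

text \<open>
One law \<open>Q\<close> of the data serves all shrinkage functions \<open>\<delta>\<close> at once, including \<open>\<delta> = 0\<close>, which is the
UMVU estimator. Risks are extended nonnegative reals; the nonnegativity assertion makes their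
comparison one of real expectations.
\<close>

lemma risk_shrinkage_eq:
  assumes obs: "neg_multinomial_observations N m r p (P p) X" and N: "1 \<le> N" and n: "n \<in> {1..N}"
    and p: "\<And>\<nu> i. \<nu> \<in> {1..n} \<Longrightarrow> i \<in> {1..m \<nu>} \<Longrightarrow> 0 < p \<nu> i"
    and c: "\<And>\<nu> i. \<nu> \<in> {1..n} \<Longrightarrow> i \<in> {1..m \<nu>} \<Longrightarrow> 0 \<le> c \<nu> i"
    and r: "\<And>\<nu>. \<nu> \<in> {1..n} \<Longrightarrow> 1 \<le> r \<nu>"
  obtains Q :: "counts pmf"
  where "\<And>x. x \<in> count_arrays N m \<Longrightarrow>
           pmf Q x = (\<Prod>\<nu>=1..N. neg_multinomial_mass (m \<nu>) (r \<nu>) (p \<nu>) (x \<nu>))"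
    and "\<And>\<delta>. (\<And>\<nu> z. \<nu> \<in> {1..n} \<Longrightarrow> 0 \<le> \<delta> \<nu> z) \<Longrightarrow> integrable (measure_pmf Q) (unbiased_loss n N m r c \<delta>)"
    and "\<And>\<delta>. (\<And>\<nu> z. \<nu> \<in> {1..n} \<Longrightarrow> 0 \<le> \<delta> \<nu> z) \<Longrightarrow>
           0 \<le> measure_pmf.expectation Q (unbiased_loss n N m r c \<delta>)
              + (\<Sum>\<nu>=1..n. \<Sum>i=1..m \<nu>. c \<nu> i * p \<nu> i)"
    and "\<And>\<delta>. (\<And>\<nu> z. \<nu> \<in> {1..n} \<Longrightarrow> 0 \<le> \<delta> \<nu> z) \<Longrightarrow>
           risk (loss n m c) P X (shrinkage_estimator N m r \<delta>) p
           = ennreal (measure_pmf.expectation Q (unbiased_loss n N m r c \<delta>)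
              + (\<Sum>\<nu>=1..n. \<Sum>i=1..m \<nu>. c \<nu> i * p \<nu> i))"
proof -
  define Y where "Y \<omega> = restrict_counts N m (\<lambda>\<nu> i. X \<nu> i \<omega>)" for \<omega>
  obtain Q :: "counts pmf" where Y: "Y \<in> P p \<rightarrow>\<^sub>M count_space UNIV"
    and distr: "distr (P p) (count_space UNIV) Y = measure_pmf Q"
    and law: "\<And>x. x \<in> count_arrays N m \<Longrightarrow>
           pmf Q x = (\<Prod>\<nu>=1..N. neg_multinomial_mass (m \<nu>) (r \<nu>) (p \<nu>) (x \<nu>))"
    and null: "\<And>x. x \<notin> count_arrays N m \<Longrightarrow> pmf Q x = 0"
    using observations_law[OF obs N] unfolding Y_def[abs_def] by blast
  have nonneg: "0 \<le> loss n m c d p" for d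
    unfolding loss_def
  proof (intro sum_nonneg mult_nonneg_nonneg)
    fix \<nu> i assume *: "\<nu> \<in> {1..n}" "i \<in> {1..m \<nu>}"
    show "0 \<le> (d \<nu> i - p \<nu> i)\<^sup>2 / p \<nu> i"
      using p[OF *] by simp
  qed (use c in auto)
  note E = expectation_loss[where p=p and c=c, OF law null n p r]
  show ?thesis
  proof (rule that[OF law])
    fix \<delta> :: "nat \<Rightarrow> nat \<Rightarrow> real"
    assume \<delta>: "\<And>\<nu> z. \<nu> \<in> {1..n} \<Longrightarrow> 0 \<le> \<delta> \<nu> z"
    show "integrable (measure_pmf Q) (unbiased_loss n N m r c \<delta>)"
      by (rule E(2)) (use \<delta> in auto)
    have eq: "measure_pmf.expectation Q (\<lambda>x. loss n m c (shrinkage_estimator N m r \<delta> x) p)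
         = measure_pmf.expectation Q (unbiased_loss n N m r c \<delta>)
           + (\<Sum>\<nu>=1..n. \<Sum>i=1..m \<nu>. c \<nu> i * p \<nu> i)"
      by (rule E(3)) (use \<delta> in auto)
    show "0 \<le> measure_pmf.expectation Q (unbiased_loss n N m r c \<delta>)
              + (\<Sum>\<nu>=1..n. \<Sum>i=1..m \<nu>. c \<nu> i * p \<nu> i)"
      unfolding eq[symmetric] by (intro integral_nonneg_AE AE_I2 nonneg)
    have "risk (loss n m c) P X (shrinkage_estimator N m r \<delta>) p
        = (\<integral>\<^sup>+ \<omega>. ennreal (loss n m c (shrinkage_estimator N m r \<delta> (Y \<omega>)) p) \<partial>P p)"
      unfolding risk_def Y_def loss_shrinkage_restrict_counts[OF n] ..
    also have "\<dots> = (\<integral>\<^sup>+ x. ennreal (loss n m c (shrinkage_estimator N m r \<delta> x) p) \<partial>measure_pmf Q)"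
      unfolding distr[symmetric] by (subst nn_integral_distr[OF Y]) auto
    also have "\<dots> = ennreal (measure_pmf.expectation Q (\<lambda>x. loss n m c (shrinkage_estimator N m r \<delta> x) p))"
      by (intro nn_integral_eq_integral AE_I2 nonneg E(1)) (use \<delta> in auto)
    finally show "risk (loss n m c) P X (shrinkage_estimator N m r \<delta>) p
           = ennreal (measure_pmf.expectation Q (unbiased_loss n N m r c \<delta>)
              + (\<Sum>\<nu>=1..n. \<Sum>i=1..m \<nu>. c \<nu> i * p \<nu> i))"
      unfolding eq .
  qed
qed

section \<open>Domination\<close>

lemma neg_multinomial_mass_zero_pos:
  assumes "0 < s" "(\<Sum>i=1..k. q i) < 1" "\<And>i. i \<in> {1..k} \<Longrightarrow> x i = 0"
  shows "0 < neg_multinomial_mass k s q x"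
proof -
  have "Gamma s \<noteq> 0"
    using Gamma_real_pos[OF assms(1)] by (rule less_imp_neq[symmetric])
  then show ?thesis
    using assms by (simp add: neg_multinomial_mass_def)
qed

lemma param_space_nonempty: "param_space N m \<noteq> {}"
proof -
  have "(\<lambda>i\<in>{1..k}. 1 / (real k + 1)) \<in> prob_simplex k" for k
    by (auto simp: prob_simplex_def divide_simps)
  then have "(\<lambda>\<nu>\<in>{1..N}. \<lambda>i\<in>{1..m \<nu>}. 1 / (real (m \<nu>) + 1)) \<in> param_space N m"
    by (auto simp: param_space_def)
  then show ?thesis by blast
qed

lemma shrinkage_estimator_zero: "shrinkage_estimator N m r (\<lambda>_ _. 0) = umvu_estimator m r"
  by (simp add: shrinkage_estimator_def umvu_estimator_def fun_eq_iff)

text \<open>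
The gap \<open>g a - f a\<close> at a single atom \<open>a\<close> already separates the expectations.
\<close>

lemma (in prob_space) expectation_strict_mono:
  fixes f g :: "'a \<Rightarrow> real"
  assumes "integrable M f" "integrable M g" "\<And>x. f x \<le> g x"
    and "f a < g a" "{a} \<in> events" "0 < prob {a}"
  shows "expectation f < expectation g"
proof -
  have "0 < prob {a} * (g a - f a)"
    using assms by simp
  also have "\<dots> = expectation (\<lambda>x. indicator {a} x * (g a - f a))"
    using assms(5) by simp
  also have "\<dots> \<le> expectation (\<lambda>x. g x - f x)"
    using assms by (intro integral_mono) (auto simp: emeasure_eq_measure split: split_indicator)
  also have "\<dots> = expectation g - expectation f"
    using assms by simp
  finally show ?thesis by simp
qed

theorem theorem2p1:
  fixes N n :: nat
    and m :: "nat \<Rightarrow> nat"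
    and r :: "nat \<Rightarrow> real"
    and c :: "nat \<Rightarrow> nat \<Rightarrow> real"
    and \<delta> :: "nat \<Rightarrow> nat \<Rightarrow> real"
    and P :: "(nat \<Rightarrow> nat \<Rightarrow> real) \<Rightarrow> 'w measure"
    and X :: "nat \<Rightarrow> nat \<Rightarrow> 'w \<Rightarrow> nat"
  assumes "1 \<le> N"
    and "n \<in> {1..N}"
    and "\<And>\<nu>. \<nu> \<in> {1..N} \<Longrightarrow> 1 \<le> m \<nu>"
    and "\<And>\<nu>. \<nu> \<in> {1..N} \<Longrightarrow> 0 < r \<nu>"
    and "\<And>\<nu> i. \<nu> \<in> {1..N} \<Longrightarrow> i \<in> {1..m \<nu>} \<Longrightarrow> 0 \<le> c \<nu> i"
    and "\<And>p. p \<in> param_space N m \<Longrightarrow> neg_multinomial_observations N m r p (P p) X"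
    and "\<And>\<nu> x. \<nu> \<in> {1..N} \<Longrightarrow> 0 < \<delta> \<nu> x"
    and "\<And>\<nu>. \<nu> \<in> {1..n} \<Longrightarrow> 0 < c_total m c \<nu> \<Longrightarrow> 5 / 2 \<le> r \<nu>"
    and "0 < 3 * c_max n m c" and "3 * c_max n m c \<le> c_total_min n m c"
    and "\<And>\<nu> x. \<nu> \<in> {1..n} \<Longrightarrow> 0 < c_total m c \<nu> \<Longrightarrow> 1 \<le> x \<Longrightarrow>
           real x * \<delta> \<nu> x \<le> real (x + 1) * \<delta> \<nu> (x + 1)"
    and "\<And>x. 1 \<le> x \<Longrightarrow> condition_i n m r c \<delta> x \<or> condition_ii n m r c \<delta> x"
  shows "dominates (param_space N m) (loss n m c) P X
           (shrinkage_estimator N m r \<delta>) (umvu_estimator m r)"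
proof -
  note N = assms(1) and n = assms(2) and m = assms(3) and r = assms(4) and c = assms(5)
    and obs = assms(6) and \<delta> = assms(7) and r52 = assms(8) and c_pos = assms(9)
    and c_le = assms(10) and mono = assms(11) and cond = assms(12)
  have le_N: "\<nu> \<in> {1..N}" if "\<nu> \<in> {1..n}" for \<nu>
    using that n by auto
  have C: "0 < c_total m c \<nu>" if "\<nu> \<in> {1..n}" for \<nu>
  proof -
    have "c_total_min n m c \<le> c_total m c \<nu>"
      unfolding c_total_min_def using that by (intro Min_le) auto
    then show ?thesis using c_pos c_le by linarith
  qed
  have less: "risk (loss n m c) P X (shrinkage_estimator N m r \<delta>) p
      < risk (loss n m c) P X (umvu_estimator m r) p" if p: "p \<in> param_space N m" for p
  proof -
    let ?u = "unbiased_loss n N m r c"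
    let ?const = "\<Sum>\<nu>=1..n. \<Sum>i=1..m \<nu>. c \<nu> i * p \<nu> i"
    \<comment> \<open>The representative of the array without any count, an atom of every law.\<close>
    let ?o = "restrict_counts N m (\<lambda>_ _. 0)"
    have simplex: "p \<nu> \<in> prob_simplex (m \<nu>)" if "\<nu> \<in> {1..N}" for \<nu>
      using p that unfolding param_space_def by (rule PiE_mem)
    have p_pos: "0 < p \<nu> i" if "\<nu> \<in> {1..n}" "i \<in> {1..m \<nu>}" for \<nu> i
      using simplex[OF le_N[OF that(1)]] that(2) by (auto simp: prob_simplex_def)
    have r1: "1 \<le> r \<nu>" if "\<nu> \<in> {1..n}" for \<nu>
      using r52[OF that C[OF that]] by simp
    have c_n: "0 \<le> c \<nu> i" if "\<nu> \<in> {1..n}" "i \<in> {1..m \<nu>}" for \<nu> i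
      using c[OF le_N[OF that(1)] that(2)] .
    obtain Q :: "counts pmf" where
      law: "\<And>x. x \<in> count_arrays N m \<Longrightarrow>
           pmf Q x = (\<Prod>\<nu>=1..N. neg_multinomial_mass (m \<nu>) (r \<nu>) (p \<nu>) (x \<nu>))"
      and int: "\<And>\<delta>. (\<And>\<nu> z. \<nu> \<in> {1..n} \<Longrightarrow> 0 \<le> \<delta> \<nu> z) \<Longrightarrow> integrable (measure_pmf Q) (?u \<delta>)"
      and nonneg: "\<And>\<delta>. (\<And>\<nu> z. \<nu> \<in> {1..n} \<Longrightarrow> 0 \<le> \<delta> \<nu> z) \<Longrightarrow>
           0 \<le> measure_pmf.expectation Q (?u \<delta>) + ?const"
      and risk: "\<And>\<delta>. (\<And>\<nu> z. \<nu> \<in> {1..n} \<Longrightarrow> 0 \<le> \<delta> \<nu> z) \<Longrightarrow>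
           risk (loss n m c) P X (shrinkage_estimator N m r \<delta>) p
           = ennreal (measure_pmf.expectation Q (?u \<delta>) + ?const)"
      by (rule risk_shrinkage_eq[where P = P and p = p and m = m and c = c and r = r, OF obs[OF p] N n p_pos c_n r1])
         (use le_N in blast)+
    have \<delta>0: "0 \<le> \<delta> \<nu> z" if "\<nu> \<in> {1..n}" for \<nu> z
      using \<delta>[OF le_N[OF that]] by (rule less_imp_le)
    have strict: "?u \<delta> x < ?u (\<lambda>_ _. 0) x"
      if "\<And>\<nu> i. \<nu> \<in> {1..n} \<Longrightarrow> i \<in> {1..m \<nu>} \<Longrightarrow> x \<nu> i = 0" for x
      using n r \<delta> le_N C that by (intro unbiased_loss_less_at_zero) auto
    have le: "?u \<delta> x \<le> ?u (\<lambda>_ _. 0) x" for x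
    proof (cases "grand_total N m x = 0")
      case True
      then have "x \<nu> i = 0" if "\<nu> \<in> {1..n}" "i \<in> {1..m \<nu>}" for \<nu> i
        using le_N[OF that(1)] that(2) by (simp add: grand_total_def row_total_def)
      then show ?thesis
        using strict[of x] by simp
    next
      case False
      then have Z: "1 \<le> grand_total N m x" by simp
      show ?thesis
        by (rule unbiased_loss_le[OF n _ _ _ c_le _ _ cond[OF Z] Z])
           (use r52 C m c \<delta> mono le_N in auto)
    qed
    have "?o \<in> count_arrays N m"
      by (auto simp: restrict_counts_def count_arrays_def)
    then have "0 < pmf Q ?o"
      using r simplex unfolding law[OF \<open>?o \<in> count_arrays N m\<close>]
      by (intro prod_pos neg_multinomial_mass_zero_pos ballI)
         (auto simp: prob_simplex_def restrict_counts_def)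
    moreover have "?u \<delta> ?o < ?u (\<lambda>_ _. 0) ?o"
      by (rule strict) (use le_N in \<open>auto simp: restrict_counts_def\<close>)
    ultimately have "measure_pmf.expectation Q (?u \<delta>) < measure_pmf.expectation Q (?u (\<lambda>_ _. 0))"
      by (intro measure_pmf.expectation_strict_mono[where a = ?o] int le \<delta>0)
         (auto simp: measure_pmf_single)
    then show ?thesis
      unfolding shrinkage_estimator_zero[of N, symmetric]
      using risk[OF \<delta>0] risk[of "\<lambda>_ _. 0"] nonneg[OF \<delta>0]
      by (simp add: ennreal_less_iff)
  qed
  then show ?thesis
    unfolding dominates_def using param_space_nonempty by (blast intro: less_imp_le)
qed

end
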